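(* Let $\mathfrak g$ be a complex semisimple Lie algebra with Cartan subalgebra $\mathfrak a$ and simple root system $\Pi=\Pi^0\cup\Pi^1=\{\alpha_1,\dots,\alpha_\ell\}$ (the decomposition corresponding to a fundamental gradation of $\mathfrak g$), and let $\pi_i$ denote the fundamental weight corresponding to the simple root $\alpha_i$, namely $2\frac{(\pi_i,\alpha_j)}{(\alpha_j,\alpha_j)}=\delta_{ij}$. If $P^1=\{\pi_{i_1},\dots,\pi_{i_r}\}$ is the set of fundamental weights corresponding to the simple roots in $\Pi^1$, then the Koszul form $\psi$ is equal to $$\psi=2\sum_{\pi\in P^1}n_\pi\pi=2\sum_{h=1}^ra_{i_h}\pi_{i_h},$$ where $$a_{i_h}=2+b_{i_h},\qquad b_{i_h}=-2\frac{(\delta^{\mathfrak h},\alpha_{i_h})}{(\alpha_{i_h},\alpha_{i_h})}\ge 0.$$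
   Context: The gradation $\mathfrak g=\sum_p\mathfrak g_p$ corresponding to $\Pi=\Pi^0\cup\Pi^1$ is given by the grading element $d\in\mathfrak a$ with $\alpha(d)=0$ for $\alpha\in\Pi^0$ and $\alpha(d)=1$ for $\alpha\in\Pi^1$; $\mathfrak g_p=\{X:[d,X]=pX\}$. Put $\mathfrak h=\mathfrak g_0$, $\mathfrak m_\pm=\sum_{p>0}\mathfrak g_{\pm p}$, and let $\tilde K$ be the endomorphism of $\mathfrak g$ equal to $0$ on $\mathfrak h$ and $\pm\mathrm{Id}$ on $\mathfrak m_\pm$. The Koszul form is the linear form $\psi(X)=-\mathrm{tr}_{\mathfrak g/\mathfrak h}(\mathrm{ad}_{\tilde KX}-\tilde K\,\mathrm{ad}_X)$ on $\mathfrak g$. Let $R^+$ be the positive roots with respect to $\Pi$, $R_0^+=\{\alpha\in R^+:\mathfrak g_\alpha\subset\mathfrak g_0\}$, and $\delta^{\mathfrak h}=\sum_{\alpha\in R_0^+}\alpha$ (note: the full sum, without factor $\tfrac12$). Linear forms on $\mathfrak a$ are regarded as linear forms on $\mathfrak g$ vanishing on all root spaces. $(\cdot,\cdot)$ is the scalar product on roots and weights induced by the Killing form. In the first sum, $n_\pi$ denotes the coefficient $a_{i_h}$ of $\pi=\pi_{i_h}$. *)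

theory Defs
  imports Complex_Main
begin

class complex_lie_algebra = ab_group_add +
  fixes cscale :: "complex \<Rightarrow> 'a \<Rightarrow> 'a"  (infixr "*\<^sub>C" 75)
    and lie :: "'a \<Rightarrow> 'a \<Rightarrow> 'a"
  assumes cscale_add_right: "c *\<^sub>C (x + y) = c *\<^sub>C x + c *\<^sub>C y"
    and cscale_add_left: "(c + c') *\<^sub>C x = c *\<^sub>C x + c' *\<^sub>C x"
    and cscale_cscale: "c *\<^sub>C c' *\<^sub>C x = (c * c') *\<^sub>C x"
    and cscale_one: "1 *\<^sub>C x = x"
    and cfinite_dim: "\<exists>B. finite B \<and> (\<forall>x. \<exists>k. x = (\<Sum>b\<in>B. k b *\<^sub>C b))"
    and lie_add_left: "lie (x + y) z = lie x z + lie y z"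
    and lie_add_right: "lie z (x + y) = lie z x + lie z y"
    and lie_cscale_left: "lie (c *\<^sub>C x) y = c *\<^sub>C lie x y"
    and lie_cscale_right: "lie x (c *\<^sub>C y) = c *\<^sub>C lie x y"
    and lie_self: "lie x x = 0"
    and lie_jacobi: "lie x (lie y z) + lie y (lie z x) + lie z (lie x y) = 0"

global_interpretation cvec: vector_space "cscale :: complex \<Rightarrow> 'g \<Rightarrow> 'g::complex_lie_algebra"
  by unfold_locales (simp_all add: cscale_add_right cscale_add_left cscale_cscale cscale_one)

abbreviation linear_endo :: "('g::complex_lie_algebra \<Rightarrow> 'g) \<Rightarrow> bool" where
  "linear_endo A \<equiv> Vector_Spaces.linear (*\<^sub>C) (*\<^sub>C) A"

abbreviation linear_form :: "('g::complex_lie_algebra \<Rightarrow> complex) \<Rightarrow> bool" where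
  "linear_form f \<equiv> Vector_Spaces.linear (*\<^sub>C) (*) f"

definition lie_ideal :: "'g::complex_lie_algebra set \<Rightarrow> bool" where
  "lie_ideal I \<longleftrightarrow> cvec.subspace I \<and> (\<forall>X. \<forall>Y\<in>I. lie X Y \<in> I)"

primrec derived_series :: "'g::complex_lie_algebra set \<Rightarrow> nat \<Rightarrow> 'g set" where
  "derived_series I 0 = I"
| "derived_series I (Suc n) =
     cvec.span {lie X Y | X Y. X \<in> derived_series I n \<and> Y \<in> derived_series I n}"

definition solvable :: "'g::complex_lie_algebra set \<Rightarrow> bool" where
  "solvable I \<longleftrightarrow> (\<exists>n. derived_series I n = {0})"

definition semisimple_lie_algebra :: "'g::complex_lie_algebra itself \<Rightarrow> bool" where
  "semisimple_lie_algebra (_ :: 'g itself) \<longleftrightarrow>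
     (\<forall>I :: 'g set. lie_ideal I \<and> solvable I \<longrightarrow> I = {0})"

text \<open>There is no quotient vector space as a type, so the quotient of the whole space by a
  subspace \<open>W\<close> is handled through representatives: \<open>quot_basis W B\<close> says that the classes of the
  elements of \<open>B\<close> modulo \<open>W\<close> are pairwise distinct and form a basis of the quotient.\<close>

definition quot_coeffs ::
  "'g::complex_lie_algebra set \<Rightarrow> 'g set \<Rightarrow> 'g \<Rightarrow> ('g \<Rightarrow> complex) \<Rightarrow> bool" where
  "quot_coeffs W B y c \<longleftrightarrow> (\<forall>b. b \<notin> B \<longrightarrow> c b = 0) \<and> y - (\<Sum>b\<in>B. c b *\<^sub>C b) \<in> W"

definition quot_basis :: "'g::complex_lie_algebra set \<Rightarrow> 'g set \<Rightarrow> bool" where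
  "quot_basis W B \<longleftrightarrow> finite B \<and> (\<forall>y. \<exists>!c. quot_coeffs W B y c)"

definition quot_coord :: "'g::complex_lie_algebra set \<Rightarrow> 'g set \<Rightarrow> 'g \<Rightarrow> 'g \<Rightarrow> complex" where
  "quot_coord W B y = (THE c. quot_coeffs W B y c)"

text \<open>Trace of the endomorphism of the quotient by \<open>W\<close> induced by a linear map \<open>A\<close> that maps \<open>W\<close>
  into itself; a basis exists by \<open>quot_basis_exists\<close>, and the choice is irrelevant
  by \<open>quot_trace_eq\<close> below.\<close>

definition quot_trace :: "'g::complex_lie_algebra set \<Rightarrow> ('g \<Rightarrow> 'g) \<Rightarrow> complex" where
  "quot_trace W A = (let B = (SOME B. quot_basis W B) in \<Sum>b\<in>B. quot_coord W B (A b) b)"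

definition endo_trace :: "('g::complex_lie_algebra \<Rightarrow> 'g) \<Rightarrow> complex" where
  "endo_trace A = quot_trace {0} A"

lemma quot_basis_exists:
  fixes W :: "'g::complex_lie_algebra set"
  assumes W: "cvec.subspace W"
  shows "\<exists>B. quot_basis W B"
proof -
  obtain F :: "'g set" where F: "finite F" "\<And>x. \<exists>k. x = (\<Sum>b\<in>F. k b *\<^sub>C b)"
    using cfinite_dim by blast
  have spanF: "x \<in> cvec.span F" for x
  proof -
    obtain k where "x = (\<Sum>b\<in>F. k b *\<^sub>C b)" using F(2) by blast
    then show ?thesis
      by (metis (mono_tags) cvec.span_sum cvec.span_scale cvec.span_base)
  qed
  obtain D where D: "D \<subseteq> W" "cvec.independent D" "W \<subseteq> cvec.span D"
    using cvec.maximal_independent_subset by blast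
  have spanD: "cvec.span D = W"
    using D W cvec.span_minimal by blast
  define C where "C = cvec.extend_basis D"
  have C: "cvec.independent C" "D \<subseteq> C" "cvec.span C = UNIV"
    using D(2) by (simp_all add: C_def cvec.independent_extend_basis cvec.extend_basis_superset)
  have finC: "finite C"
    using cvec.independent_span_bound[OF F(1) C(1)] spanF by blast
  define B where "B = C - D"
  have fin: "finite B" "finite D" "C = B \<union> D" "B \<inter> D = {}"
    using finC C(2) by (auto simp: B_def intro: finite_subset)
  have in_W: "(\<exists>k. w = (\<Sum>b\<in>D. k b *\<^sub>C b)) \<longleftrightarrow> w \<in> W" for w
    using cvec.span_finite[OF fin(2)] spanD by auto
  have ex: "\<exists>c. quot_coeffs W B y c" for y
  proof -
    obtain k where k: "y = (\<Sum>b\<in>C. k b *\<^sub>C b)"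
      using cvec.span_finite[OF finC] C(3) by auto
    have "y - (\<Sum>b\<in>B. k b *\<^sub>C b) = (\<Sum>b\<in>D. k b *\<^sub>C b)"
      unfolding k fin(3) by (subst sum.union_disjoint) (use fin in auto)
    then have "quot_coeffs W B y (\<lambda>b. if b \<in> B then k b else 0)"
      unfolding quot_coeffs_def using in_W by (auto cong: sum.cong)
    then show ?thesis by blast
  qed
  have un: "c = c'" if c: "quot_coeffs W B y c" "quot_coeffs W B y c'" for y c c'
  proof -
    have "(y - (\<Sum>b\<in>B. c' b *\<^sub>C b)) - (y - (\<Sum>b\<in>B. c b *\<^sub>C b)) \<in> W"
      using c W unfolding quot_coeffs_def by (blast intro: cvec.subspace_diff)
    then have "(\<Sum>b\<in>B. (c b - c' b) *\<^sub>C b) \<in> W"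
      by (simp add: cvec.scale_left_diff_distrib sum_subtractf)
    then obtain k where k: "(\<Sum>b\<in>B. (c b - c' b) *\<^sub>C b) = (\<Sum>b\<in>D. k b *\<^sub>C b)"
      using in_W by metis
    define u where "u b = (if b \<in> B then c b - c' b else - k b)" for b
    have "(\<Sum>b\<in>C. u b *\<^sub>C b) = (\<Sum>b\<in>B. u b *\<^sub>C b) + (\<Sum>b\<in>D. u b *\<^sub>C b)"
      unfolding fin(3) by (subst sum.union_disjoint) (use fin in auto)
    also have "(\<Sum>b\<in>B. u b *\<^sub>C b) = (\<Sum>b\<in>B. (c b - c' b) *\<^sub>C b)"
      by (simp add: u_def)
    also have "(\<Sum>b\<in>D. u b *\<^sub>C b) = (\<Sum>b\<in>D. - (k b *\<^sub>C b))"
      by (rule sum.cong) (use fin in \<open>auto simp: u_def\<close>)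
    finally have "(\<Sum>b\<in>C. u b *\<^sub>C b) = 0"
      using k by (simp add: sum_negf)
    then have "\<forall>b\<in>C. u b = 0"
      using cvec.independentD[OF C(1) finC subset_refl] by blast
    then have "\<forall>b\<in>B. c b = c' b"
      using fin by (auto simp: u_def split: if_splits)
    then show ?thesis
      using c unfolding quot_coeffs_def by (intro ext) metis
  qed
  have "quot_basis W B"
    unfolding quot_basis_def using fin(1) ex un by blast
  then show ?thesis by blast
qed

lemma quot_coord_coeffs:
  assumes "quot_basis W B"
  shows "quot_coeffs W B y (quot_coord W B y)"
  using assms unfolding quot_basis_def quot_coord_def by (metis theI')

lemma quot_coord_eqI:
  assumes "quot_basis W B" "quot_coeffs W B y c"
  shows "quot_coord W B y = c"
  using assms quot_coord_coeffs unfolding quot_basis_def by blast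

lemma quot_coord_combination:
  fixes W :: "'g::complex_lie_algebra set"
  assumes W: "cvec.subspace W" and B: "quot_basis W B"
    and y: "y - (\<Sum>i\<in>I. k i *\<^sub>C f i) \<in> W"
  shows "quot_coord W B y b = (\<Sum>i\<in>I. k i * quot_coord W B (f i) b)"
proof -
  let ?c = "\<lambda>i. quot_coord W B (f i)"
  have c: "quot_coeffs W B (f i) (?c i)" for i
    using quot_coord_coeffs[OF B] .
  have "(\<Sum>i\<in>I. k i *\<^sub>C (f i - (\<Sum>b\<in>B. ?c i b *\<^sub>C b))) \<in> W"
    by (rule cvec.subspace_sum[OF W], rule cvec.subspace_scale[OF W])
       (use c in \<open>simp add: quot_coeffs_def\<close>)
  then have "(y - (\<Sum>i\<in>I. k i *\<^sub>C f i)) + (\<Sum>i\<in>I. k i *\<^sub>C (f i - (\<Sum>b\<in>B. ?c i b *\<^sub>C b))) \<in> W"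
    using y cvec.subspace_add[OF W] by blast
  also have "(y - (\<Sum>i\<in>I. k i *\<^sub>C f i)) + (\<Sum>i\<in>I. k i *\<^sub>C (f i - (\<Sum>b\<in>B. ?c i b *\<^sub>C b)))
      = y - (\<Sum>i\<in>I. \<Sum>b\<in>B. (k i * ?c i b) *\<^sub>C b)"
    by (simp add: cvec.scale_right_diff_distrib sum_subtractf cvec.scale_sum_right)
  also have "(\<Sum>i\<in>I. \<Sum>b\<in>B. (k i * ?c i b) *\<^sub>C b) = (\<Sum>b\<in>B. (\<Sum>i\<in>I. k i * ?c i b) *\<^sub>C b)"
    by (subst sum.swap) (simp add: cvec.scale_sum_left)
  finally have "quot_coeffs W B y (\<lambda>b. \<Sum>i\<in>I. k i * ?c i b)"
    using c by (simp add: quot_coeffs_def)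
  then show ?thesis
    using quot_coord_eqI[OF B] by metis
qed

lemma quot_trace_eq:
  fixes W :: "'g::complex_lie_algebra set"
  assumes W: "cvec.subspace W" and A: "linear_endo A" and inv: "A ` W \<subseteq> W"
    and B: "quot_basis W B"
  shows "quot_trace W A = (\<Sum>b\<in>B. quot_coord W B (A b) b)"
proof -
  define B' where "B' = (SOME B. quot_basis W B)"
  have B': "quot_basis W B'"
    unfolding B'_def using B by (rule someI)
  interpret A: Vector_Spaces.linear "(*\<^sub>C)" "(*\<^sub>C)" A by (rule A)
  let ?c = "quot_coord W B" and ?c' = "quot_coord W B'"
  have step: "y - (\<Sum>b\<in>B. ?c y b *\<^sub>C b) \<in> W" for y
    using quot_coord_coeffs[OF B] by (simp add: quot_coeffs_def)
  have "A (y - (\<Sum>b\<in>B. ?c y b *\<^sub>C b)) \<in> W" for y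
    using step inv by blast
  then have Astep: "A y - (\<Sum>b\<in>B. ?c y b *\<^sub>C A b) \<in> W" for y
    by (simp add: A.diff A.sum A.scale)
  have step': "y - (\<Sum>b\<in>B'. ?c' y b *\<^sub>C b) \<in> W" for y
    using quot_coord_coeffs[OF B'] by (simp add: quot_coeffs_def)
  have "quot_trace W A = (\<Sum>b'\<in>B'. ?c' (A b') b')"
    by (simp add: quot_trace_def B'_def Let_def)
  also have "\<dots> = (\<Sum>b'\<in>B'. \<Sum>b\<in>B. ?c b' b * ?c' (A b) b')"
    by (rule sum.cong[OF refl], rule quot_coord_combination[OF W B' Astep])
  also have "\<dots> = (\<Sum>b\<in>B. \<Sum>b'\<in>B'. ?c' (A b) b' * ?c b' b)"
    by (subst sum.swap) (simp add: mult.commute)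
  also have "\<dots> = (\<Sum>b\<in>B. ?c (A b) b)"
    by (rule sum.cong[OF refl], rule quot_coord_combination[OF W B step', symmetric])
  finally show ?thesis .
qed

definition killing :: "'g::complex_lie_algebra \<Rightarrow> 'g \<Rightarrow> complex" where
  "killing X Y = endo_trace (\<lambda>Z. lie X (lie Y Z))"

definition diagonalizable :: "('g::complex_lie_algebra \<Rightarrow> 'g) \<Rightarrow> bool" where
  "diagonalizable A \<longleftrightarrow>
     (\<exists>B. cvec.independent B \<and> cvec.span B = UNIV \<and> (\<forall>X\<in>B. \<exists>c. A X = c *\<^sub>C X))"

definition abelian_subalgebra :: "'g::complex_lie_algebra set \<Rightarrow> bool" where
  "abelian_subalgebra \<aa> \<longleftrightarrow> cvec.subspace \<aa> \<and> (\<forall>X\<in>\<aa>. \<forall>Y\<in>\<aa>. lie X Y = 0)"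

text \<open>Helgason's definition for a complex semisimple Lie algebra: a maximal abelian subalgebra all
  of whose elements act semisimply.\<close>

definition cartan_subalgebra :: "'g::complex_lie_algebra set \<Rightarrow> bool" where
  "cartan_subalgebra \<aa> \<longleftrightarrow>
     abelian_subalgebra \<aa> \<and>
     (\<forall>\<bb>. abelian_subalgebra \<bb> \<and> \<aa> \<subseteq> \<bb> \<longrightarrow> \<bb> = \<aa>) \<and>
     (\<forall>H\<in>\<aa>. diagonalizable (lie H))"

definition root_space ::
  "'g::complex_lie_algebra set \<Rightarrow> ('g \<Rightarrow> complex) \<Rightarrow> 'g set" where
  "root_space \<aa> \<nu> = {X. \<forall>H\<in>\<aa>. lie H X = \<nu> H *\<^sub>C X}"

text \<open>Linear forms on the Cartan subalgebra are represented throughout by linear forms on the whole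
  Lie algebra that vanish on all root spaces. Only the restriction of \<open>\<nu>\<close> to \<open>\<aa>\<close> matters
  in \<open>root_space \<aa> \<nu>\<close>, so \<open>\<nu>\<close> may range over all linear forms that do not vanish on \<open>\<aa>\<close>.\<close>

definition cartan_forms :: "'g::complex_lie_algebra set \<Rightarrow> ('g \<Rightarrow> complex) set" where
  "cartan_forms \<aa> = {f. linear_form f \<and>
     (\<forall>\<nu>. linear_form \<nu> \<and> (\<exists>H\<in>\<aa>. \<nu> H \<noteq> 0) \<longrightarrow> (\<forall>X\<in>root_space \<aa> \<nu>. f X = 0))}"

definition lie_roots :: "'g::complex_lie_algebra set \<Rightarrow> ('g \<Rightarrow> complex) set" where
  "lie_roots \<aa> = {\<alpha> \<in> cartan_forms \<aa>. (\<exists>H\<in>\<aa>. \<alpha> H \<noteq> 0) \<and> root_space \<aa> \<alpha> \<noteq> {0}}"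

definition dual_vector :: "'g::complex_lie_algebra set \<Rightarrow> ('g \<Rightarrow> complex) \<Rightarrow> 'g" where
  "dual_vector \<aa> \<nu> = (THE T. T \<in> \<aa> \<and> (\<forall>H\<in>\<aa>. killing T H = \<nu> H))"

definition form_inner ::
  "'g::complex_lie_algebra set \<Rightarrow> ('g \<Rightarrow> complex) \<Rightarrow> ('g \<Rightarrow> complex) \<Rightarrow> complex" where
  "form_inner \<aa> \<nu> \<mu> = killing (dual_vector \<aa> \<nu>) (dual_vector \<aa> \<mu>)"

definition nonneg_comb ::
  "('g::complex_lie_algebra \<Rightarrow> complex) set \<Rightarrow> ('g \<Rightarrow> complex) \<Rightarrow> bool" where
  "nonneg_comb \<Pi> \<beta> \<longleftrightarrow> (\<exists>n :: ('g \<Rightarrow> complex) \<Rightarrow> nat. \<beta> = (\<lambda>X. \<Sum>\<alpha>\<in>\<Pi>. of_nat (n \<alpha>) * \<alpha> X))"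

definition simple_root_system ::
  "'g::complex_lie_algebra set \<Rightarrow> ('g \<Rightarrow> complex) set \<Rightarrow> bool" where
  "simple_root_system \<aa> \<Pi> \<longleftrightarrow>
     finite \<Pi> \<and> \<Pi> \<subseteq> lie_roots \<aa> \<and>
     (\<forall>c. (\<forall>X. (\<Sum>\<alpha>\<in>\<Pi>. c \<alpha> * \<alpha> X) = 0) \<longrightarrow> (\<forall>\<alpha>\<in>\<Pi>. c \<alpha> = 0)) \<and>
     (\<forall>\<beta>\<in>lie_roots \<aa>. nonneg_comb \<Pi> \<beta> \<or> nonneg_comb \<Pi> (\<lambda>X. - \<beta> X))"

definition positive_roots ::
  "'g::complex_lie_algebra set \<Rightarrow> ('g \<Rightarrow> complex) set \<Rightarrow> ('g \<Rightarrow> complex) set" where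
  "positive_roots \<aa> \<Pi> = {\<beta> \<in> lie_roots \<aa>. nonneg_comb \<Pi> \<beta>}"

definition grade_space :: "'g::complex_lie_algebra \<Rightarrow> int \<Rightarrow> 'g set" where
  "grade_space d p = {X. lie d X = of_int p *\<^sub>C X}"

definition grade_pos :: "'g::complex_lie_algebra \<Rightarrow> 'g set" where
  "grade_pos d = cvec.span (\<Union>p\<in>{0<..}. grade_space d p)"

definition grade_neg :: "'g::complex_lie_algebra \<Rightarrow> 'g set" where
  "grade_neg d = cvec.span (\<Union>p\<in>{0<..}. grade_space d (- p))"

text \<open>The endomorphism called \<open>K\<close> with a tilde in the literature.\<close>

definition para_endo :: "'g::complex_lie_algebra \<Rightarrow> 'g \<Rightarrow> 'g" where
  "para_endo d = (THE K. linear_endo K \<and> (\<forall>X\<in>grade_space d 0. K X = 0) \<and>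
     (\<forall>X\<in>grade_pos d. K X = X) \<and> (\<forall>X\<in>grade_neg d. K X = - X))"

definition koszul_form :: "'g::complex_lie_algebra \<Rightarrow> 'g \<Rightarrow> complex" where
  "koszul_form d X =
     - quot_trace (grade_space d 0) (\<lambda>Y. lie (para_endo d X) Y - para_endo d (lie X Y))"

definition grade0_positive_roots ::
  "'g::complex_lie_algebra set \<Rightarrow> ('g \<Rightarrow> complex) set \<Rightarrow> 'g \<Rightarrow> ('g \<Rightarrow> complex) set" where
  "grade0_positive_roots \<aa> \<Pi> d = {\<alpha> \<in> positive_roots \<aa> \<Pi>. root_space \<aa> \<alpha> \<subseteq> grade_space d 0}"

text \<open>The full sum of the positive roots of degree zero, without the customary factor 1/2.\<close>

definition delta_h ::
  "'g::complex_lie_algebra set \<Rightarrow> ('g \<Rightarrow> complex) set \<Rightarrow> 'g \<Rightarrow> 'g \<Rightarrow> complex" where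
  "delta_h \<aa> \<Pi> d = (\<lambda>X. \<Sum>\<alpha>\<in>grade0_positive_roots \<aa> \<Pi> d. \<alpha> X)"

end

theory Submission
  imports Defs
begin

text \<open>
The Koszul form vanishes on root vectors: for \<open>X\<close> in a root space the endomorphism in its definition
shifts weights and therefore has no diagonal entries in a basis of weight vectors. On \<open>\<aa>\<close> the same
basis gives the sum of the roots of nonzero degree, each counted with the sign of its degree.
As root spaces are one-dimensional and the roots symmetric, this is
\<open>2 * (2 * \<rho> - \<delta>)\<close>, where \<open>2 * \<rho>\<close> is the sum of all positive roots and \<open>\<delta>\<close> the sum of those of
degree zero (\<open>koszul_form_cartan\<close>). The coroots of the simple roots span \<open>\<aa>\<close>, and the fundamental weights
are dual to them, so the coefficients of the expansion in fundamental weights are the values on these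
coroots. A simple reflection permutes the positive roots other than its own root, and for \<open>\<alpha>\<close> in \<open>\<Pi>0\<close>
also those among them that have degree zero. Hence \<open>2 * \<rho>\<close> has the value \<open>2\<close> on every simple coroot and
\<open>\<delta>\<close> has the value \<open>2\<close> on the coroots of \<open>\<Pi>0\<close>; there the two cancel. On the coroot of a root \<open>\<alpha>\<close> in \<open>\<Pi>1\<close>
the value is \<open>2 - \<delta> (coroot \<alpha>) = 2 + b\<close>. The number \<open>b\<close> is nonnegative, because subtracting \<open>\<alpha>\<close> from
a positive root \<open>\<beta>\<close> of degree zero never gives a root, so that \<open>\<beta>\<close> is an extremal weight of its
\<open>\<alpha>\<close>-string (\<open>grade0_root_coroot_\<Pi>1\<close>).

The structure theory behind this starts from the absence of solvable ideals. The main
step is the nondegeneracy of the Killing form (\<open>killing_nondegenerate\<close>), which follows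
here from two facts. First, by \<open>ladder\<close>, all weights take on a bracket of
opposite root vectors real multiples of one number, so that an isotropic bracket is zero. Hence
an ideal in the radical of the Killing form that equals its derived ideal contains no nonzero element
of \<open>\<aa>\<close>. Second, a space spanned by a set of ad-nilpotent elements closed under brackets is not
perfect, by Engel's theorem in Jacobson's form (\<open>weakly_closed_nilpotent_shrinking\<close>). Coroots,
one-dimensionality and the reflections are then obtained from ladders in the usual way.
\<close>


section \<open>The bracket and vectors of distinct weights\<close>

lemma lie_zero_left [simp]: "lie 0 x = (0::'g::complex_lie_algebra)"
  using lie_cscale_left[of 0 0 x] by simp

lemma lie_zero_right [simp]: "lie x 0 = (0::'g::complex_lie_algebra)"
  using lie_cscale_right[of x 0 0] by simp

lemma lie_anti: "lie x y = - lie y (x::'g::complex_lie_algebra)"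
proof -
  have "0 = lie (x + y) (x + y)" by (simp only: lie_self)
  also have "\<dots> = lie x y + lie y x"
    unfolding lie_add_left lie_add_right by (simp add: lie_self)
  finally have "lie x y + lie y x = 0" by simp
  then show ?thesis by (simp add: eq_neg_iff_add_eq_0)
qed

lemma lie_minus_left: "lie (- x) y = - lie x (y::'g::complex_lie_algebra)"
  using lie_add_left[of "- x" x y] by (simp add: eq_neg_iff_add_eq_0)

lemma lie_minus_right: "lie x (- y) = - lie x (y::'g::complex_lie_algebra)"
  using lie_add_right[of x "- y" y] by (simp add: eq_neg_iff_add_eq_0)

lemma lie_diff_left: "lie (x - y) z = lie x z - lie y (z::'g::complex_lie_algebra)"
  using lie_add_left[of x "- y" z] by (simp add: lie_minus_left)

lemma lie_diff_right: "lie z (x - y) = lie z x - lie z (y::'g::complex_lie_algebra)"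
  using lie_add_right[of z x "- y"] by (simp add: lie_minus_right)

lemma lie_sum_left: "lie (\<Sum>i\<in>I. f i) z = (\<Sum>i\<in>I. lie (f i) (z::'g::complex_lie_algebra))"
  by (induction I rule: infinite_finite_induct) (simp_all add: lie_add_left)

lemma lie_sum_right: "lie z (\<Sum>i\<in>I. f i) = (\<Sum>i\<in>I. lie z (f i :: 'g::complex_lie_algebra))"
  by (induction I rule: infinite_finite_induct) (simp_all add: lie_add_right)

lemma lie_derivation:
  "lie x (lie y z) = lie (lie x y) z + lie y (lie x (z::'g::complex_lie_algebra))"
proof -
  have "lie x (lie y z) + lie y (lie z x) + lie z (lie x y) = 0" by (rule lie_jacobi)
  moreover have "lie y (lie z x) = - lie y (lie x z)"
    by (subst lie_anti[of z x]) (simp add: lie_minus_right)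
  moreover have "lie z (lie x y) = - lie (lie x y) z" by (rule lie_anti)
  ultimately show ?thesis by (simp add: algebra_simps)
qed

lemma linear_endoI:
  assumes "\<And>x y. A (x + y) = A x + A y" "\<And>c x. A (c *\<^sub>C x) = c *\<^sub>C A x"
  shows "linear_endo (A :: 'g::complex_lie_algebra \<Rightarrow> 'g)"
  using assms by (simp add: Vector_Spaces.linear_iff cvec.vector_space_axioms)

lemma vector_space_complex: "vector_space ((*) :: complex \<Rightarrow> complex \<Rightarrow> complex)"
  by unfold_locales (simp_all add: algebra_simps)

lemma linear_formI:
  assumes "\<And>x y. A (x + y) = A x + A y" "\<And>c x. A (c *\<^sub>C x) = c * A x"
  shows "linear_form (A :: 'g::complex_lie_algebra \<Rightarrow> complex)"
  using assms by (simp add: Vector_Spaces.linear_iff cvec.vector_space_axioms vector_space_complex)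

lemma linear_formD:
  assumes "linear_form (A :: 'g::complex_lie_algebra \<Rightarrow> complex)"
  shows linear_form_add: "A (x + y) = A x + A y"
    and linear_form_scale: "A (c *\<^sub>C x) = c * A x"
  using assms by (simp_all add: Vector_Spaces.linear_iff)

lemma linear_form_0: "linear_form A \<Longrightarrow> A (0::'g::complex_lie_algebra) = 0"
  using linear_form_scale[of A 0 0] by simp

lemma linear_form_sum:
  "linear_form A \<Longrightarrow> A (\<Sum>i\<in>I. f i :: 'g::complex_lie_algebra) = (\<Sum>i\<in>I. A (f i))"
  by (induction I rule: infinite_finite_induct)
     (simp_all add: linear_form_add linear_form_0)

lemma linear_endo_lie: "linear_endo (lie (X::'g::complex_lie_algebra))"
  by (rule linear_endoI) (simp_all add: lie_add_right lie_cscale_right)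

text \<open>An operator \<open>lie H\<close> separating two weights multiplies the corresponding components by
  different scalars, so subtracting a multiple of the given vector removes one component and keeps
  the others up to nonzero factors. The case of the zero subspace is the linear independence
  of vectors of distinct weights.\<close>

lemma weight_components_in_invariant_subspace:
  fixes x :: "'i \<Rightarrow> 'g::complex_lie_algebra" and w :: "'i \<Rightarrow> 'g \<Rightarrow> complex"
  assumes "finite I" and V: "cvec.subspace V"
    and inv: "\<And>H y. H \<in> S \<Longrightarrow> y \<in> V \<Longrightarrow> lie H y \<in> V"
    and sep: "\<And>i j. i \<in> I \<Longrightarrow> j \<in> I \<Longrightarrow> i \<noteq> j \<Longrightarrow> \<exists>H\<in>S. w i H \<noteq> w j H"
    and wt: "\<And>i H. i \<in> I \<Longrightarrow> H \<in> S \<Longrightarrow> lie H (x i) = w i H *\<^sub>C x i"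
    and sum: "(\<Sum>i\<in>I. x i) \<in> V"
    and i: "i \<in> I"
  shows "x i \<in> V"
  using assms(1,4,5,6) i
proof (induction I arbitrary: x i rule: finite_induct)
  case empty
  then show ?case by simp
next
  case (insert k I)
  have others: "x j \<in> V" if j: "j \<in> I" for j
  proof -
    have "j \<noteq> k" using insert.hyps j by auto
    then obtain H where H: "H \<in> S" "w j H \<noteq> w k H"
      using insert.prems(1)[of j k] j by auto
    define s where "s = (\<Sum>i\<in>insert k I. x i)"
    have "lie H s - w k H *\<^sub>C s \<in> V"
      using insert.prems(3) inv[OF H(1)] V unfolding s_def
      by (blast intro: cvec.subspace_diff cvec.subspace_scale)
    also have "lie H s - w k H *\<^sub>C s = (\<Sum>i\<in>insert k I. (w i H - w k H) *\<^sub>C x i)"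
      unfolding s_def lie_sum_right cvec.scale_sum_right sum_subtractf[symmetric]
      using insert.prems(2) H(1)
      by (intro sum.cong) (auto simp: cvec.scale_left_diff_distrib)
    also have "\<dots> = (\<Sum>i\<in>I. (w i H - w k H) *\<^sub>C x i)"
      using insert.hyps by simp
    finally have "(\<Sum>i\<in>I. (w i H - w k H) *\<^sub>C x i) \<in> V" .
    then have "(w j H - w k H) *\<^sub>C x j \<in> V"
      using insert.prems(1,2) j
      by (intro insert.IH[where x = "\<lambda>i. (w i H - w k H) *\<^sub>C x i"])
         (auto simp: lie_cscale_right cvec.scale_left_commute)
    then have "inverse (w j H - w k H) *\<^sub>C (w j H - w k H) *\<^sub>C x j \<in> V"
      by (rule cvec.subspace_scale[OF V])
    then show ?thesis using H(2) by (simp add: cvec.scale_scale)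
  qed
  have "(\<Sum>i\<in>insert k I. x i) - (\<Sum>i\<in>I. x i) \<in> V"
    using insert.prems(3) others V by (blast intro: cvec.subspace_diff cvec.subspace_sum)
  then have "x k \<in> V" using insert.hyps by simp
  then show ?case using others insert.prems(4) by blast
qed

section \<open>Ladders\<close>

text \<open>The classical computation in a representation of \<open>sl\<^sub>2\<close>, with the eigenvalue \<open>a\<close> of
  \<open>lie h\<close> on \<open>e\<close> kept as a parameter. The value \<open>a = 0\<close>, where the three elements span a
  Heisenberg algebra, is needed before it is known that roots do not vanish on their coroots.\<close>

lemma ladder_formula:
  fixes e f v :: "'g::complex_lie_algebra"
  assumes ev: "lie e v = 0"
    and hf: "lie (lie e f) f = - a *\<^sub>C f"
    and hv: "lie (lie e f) v = c *\<^sub>C v"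
  shows "lie (lie e f) ((lie f ^^ j) v) = (c - of_nat j * a) *\<^sub>C (lie f ^^ j) v
    \<and> lie e ((lie f ^^ Suc j) v) = ((of_nat j + 1) * (c - of_nat j * a / 2)) *\<^sub>C (lie f ^^ j) v"
proof (induction j)
  case 0
  show ?case using hv lie_derivation[of e f v] ev by simp
next
  case (Suc j)
  let ?u = "(lie f ^^ j) v"
  let ?h = "lie e f"
  have 1: "lie ?h (lie f ?u) = (c - of_nat (Suc j) * a) *\<^sub>C lie f ?u"
  proof -
    have "lie ?h (lie f ?u) = lie (lie ?h f) ?u + lie f (lie ?h ?u)"
      by (rule lie_derivation)
    also have "\<dots> = (c - of_nat (Suc j) * a) *\<^sub>C lie f ?u"
    proof -
      have "lie (lie ?h f) ?u = (- a) *\<^sub>C lie f ?u" by (simp only: hf lie_cscale_left)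
      moreover have "lie f (lie ?h ?u) = (c - of_nat j * a) *\<^sub>C lie f ?u"
        using Suc.IH by (simp only: lie_cscale_right)
      moreover have "- a + (c - of_nat j * a) = c - of_nat (Suc j) * a"
        by (simp add: algebra_simps)
      ultimately show ?thesis by (simp only: flip: cvec.scale_left_distrib)
    qed
    finally show ?thesis .
  qed
  have "lie e (lie f (lie f ?u)) = lie ?h (lie f ?u) + lie f (lie e (lie f ?u))"
    by (rule lie_derivation)
  also have "lie e (lie f ?u) = ((of_nat j + 1) * (c - of_nat j * a / 2)) *\<^sub>C ?u"
    using Suc.IH by simp
  finally have "lie e (lie f (lie f ?u)) =
      ((c - of_nat (Suc j) * a) + (of_nat j + 1) * (c - of_nat j * a / 2)) *\<^sub>C lie f ?u"
    by (simp only: 1 lie_cscale_right cvec.scale_left_distrib)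
  also have "(c - of_nat (Suc j) * a) + (of_nat j + 1) * (c - of_nat j * a / 2)
      = (of_nat (Suc j) + 1) * (c - of_nat (Suc j) * a / 2)"
    by (simp add: field_simps)
  finally show ?case using 1 by simp
qed

text \<open>When the ladder stops, the coefficient in \<open>ladder_formula\<close> at the last step must vanish.\<close>

lemma ladder:
  fixes e f v :: "'g::complex_lie_algebra"
  assumes ev: "lie e v = 0"
    and hf: "lie (lie e f) f = - a *\<^sub>C f"
    and hv: "lie (lie e f) v = c *\<^sub>C v"
    and v: "v \<noteq> 0" and nil: "(lie f ^^ n) v = 0"
  obtains k :: nat where "c = of_nat k * a / 2" "\<And>j. j \<le> k \<Longrightarrow> (lie f ^^ j) v \<noteq> 0"
proof -
  define m where "m = (LEAST n. (lie f ^^ n) v = 0)"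
  have m: "(lie f ^^ m) v = 0" "\<And>j. j < m \<Longrightarrow> (lie f ^^ j) v \<noteq> 0"
    unfolding m_def using nil by (auto intro: LeastI dest: not_less_Least)
  have "m \<noteq> 0" using m(1) v by (metis funpow_0)
  then obtain k where k: "m = Suc k" by (cases m) auto
  have "((of_nat k + 1) * (c - of_nat k * a / 2)) *\<^sub>C (lie f ^^ k) v = 0"
    using ladder_formula[OF ev hf hv, of k] m(1) unfolding k by simp
  then have "(of_nat k + 1) * (c - of_nat k * a / 2) = 0" using m(2)[of k] k by auto
  moreover have "(of_nat k + 1 :: complex) \<noteq> 0"
    by (metis of_nat_Suc of_nat_neq_0 add.commute)
  ultimately have "c = of_nat k * a / 2" by simp
  then show ?thesis using that[of k] m k by simp
qed

section \<open>Weakly closed sets of nilpotent elements\<close>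

text \<open>The ideal that has to be excluded in the proof of nondegeneracy of the Killing form is
  spanned by nilpotent weight vectors, but sums of such vectors are not known to be nilpotent.
  Hence Engel's theorem in Jacobson's form: nilpotency is required only on a set that is closed
  under brackets. The conclusion is stated dually to the existence of a common null vector: such a
  set never maps an invariant space onto itself modulo a proper invariant subspace.\<close>

definition lie_stable :: "'g::complex_lie_algebra set \<Rightarrow> 'g set \<Rightarrow> bool" where
  "lie_stable W V \<longleftrightarrow> cvec.subspace V \<and> (\<forall>w\<in>W. \<forall>x\<in>V. lie w x \<in> V)"

definition lie_closed :: "'g::complex_lie_algebra set \<Rightarrow> bool" where
  "lie_closed W \<longleftrightarrow> (\<forall>x\<in>W. \<forall>y\<in>W. lie x y \<in> W)"

definition action_span :: "'g::complex_lie_algebra set \<Rightarrow> 'g set \<Rightarrow> 'g set \<Rightarrow> 'g set" where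
  "action_span W A B = cvec.span (A \<union> {lie w x | w x. w \<in> W \<and> x \<in> B})"

definition shrinking :: "'g::complex_lie_algebra set \<Rightarrow> bool" where
  "shrinking W \<longleftrightarrow> (\<forall>A B. lie_stable W A \<and> lie_stable W B \<and> A \<subset> B \<longrightarrow> action_span W A B \<noteq> B)"

lemma span_act_in_subspace:
  assumes "w \<in> cvec.span W" "cvec.subspace V" "\<And>u. u \<in> W \<Longrightarrow> lie u x \<in> V"
  shows "lie (w::'g::complex_lie_algebra) x \<in> V"
  using assms(1)
proof (induction rule: cvec.span_induct_alt)
  case base
  show ?case using assms(2) by (simp add: cvec.subspace_0)
next
  case (step c u y)
  then show ?case
    using assms(2,3) by (simp add: lie_add_left lie_cscale_left cvec.subspace_add cvec.subspace_scale)
qed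

lemma act_on_span_in_subspace:
  assumes "y \<in> cvec.span Y" "cvec.subspace V" "\<And>u. u \<in> Y \<Longrightarrow> lie x u \<in> V"
  shows "lie (x::'g::complex_lie_algebra) y \<in> V"
  using assms(1)
proof (induction rule: cvec.span_induct_alt)
  case base
  show ?case using assms(2) by (simp add: cvec.subspace_0)
next
  case (step c u y)
  then show ?case
    using assms(2,3) by (simp add: lie_add_right lie_cscale_right cvec.subspace_add cvec.subspace_scale)
qed

lemma action_span_subset:
  assumes "lie_stable W B" "A \<subseteq> B"
  shows "action_span W A B \<subseteq> B"
  unfolding action_span_def using assms
  by (intro cvec.span_minimal) (auto simp: lie_stable_def)

lemma action_span_base:
  "x \<in> A \<Longrightarrow> x \<in> action_span W A B"
  "w \<in> W \<Longrightarrow> x \<in> B \<Longrightarrow> lie w x \<in> action_span W A B"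
  unfolding action_span_def by (auto intro: cvec.span_base)

lemma subspace_action_span: "cvec.subspace (action_span W A B)"
  by (simp add: action_span_def)

lemma action_span_stable:
  assumes "lie_stable W B" "A \<subseteq> B"
  shows "lie_stable W (action_span W A B)"
  using action_span_subset[OF assms]
  by (auto simp: lie_stable_def subspace_action_span intro: action_span_base)

text \<open>Adding to a shrinking set \<open>W'\<close> one nilpotent element \<open>v\<close> that normalises its span keeps
  it shrinking: the part of \<open>B\<close> reached by \<open>W'\<close> is a proper subspace stable under \<open>lie v\<close>, and
  the nilpotent map induced by \<open>lie v\<close> on the quotient is not surjective.\<close>

lemma shrinking_extend:
  fixes v :: "'g::complex_lie_algebra"
  assumes W': "shrinking W'" "lie_closed W'"
    and v: "\<And>w. w \<in> W' \<Longrightarrow> lie w v \<in> cvec.span W'" "\<And>x. (lie v ^^ n) x = 0"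
    and W'': "W' \<subseteq> W''" "v \<in> W''" "W'' \<subseteq> cvec.span (insert v W')"
  shows "shrinking W''"
  unfolding shrinking_def
proof (intro allI impI, elim conjE)
  fix A B assume A: "lie_stable W'' A" and B: "lie_stable W'' B" and AB: "A \<subset> B"
  have AB': "lie_stable W' A" "lie_stable W' B"
    using A B W''(1) by (auto simp: lie_stable_def)
  have vB: "lie v x \<in> B" if "x \<in> B" for x using B W''(2) that by (simp add: lie_stable_def)
  have subB: "cvec.subspace B" using B by (simp add: lie_stable_def)
  define C where "C = action_span W' A B"
  have C: "C \<noteq> B" "C \<subseteq> B" "cvec.subspace C"
    using W'(1) AB AB' action_span_subset[OF AB'(2), of A]
    by (auto simp: C_def shrinking_def subspace_action_span)
  have span_C: "lie w x \<in> C" if "w \<in> cvec.span W'" "x \<in> B" for w x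
    using that(1) C(3)
    by (rule span_act_in_subspace) (auto simp: C_def that(2) intro: action_span_base)
  have vC: "lie v y \<in> C" if "y \<in> C" for y
    using that[unfolded C_def action_span_def] C(3)
  proof (rule act_on_span_in_subspace)
    fix u assume u: "u \<in> A \<union> {lie w x |w x. w \<in> W' \<and> x \<in> B}"
    show "lie v u \<in> C"
    proof (cases "u \<in> A")
      case True
      then show ?thesis using A W''(2)
        unfolding C_def by (intro action_span_base(1)) (auto simp: lie_stable_def)
    next
      case False
      with u obtain w x where wx: "u = lie w x" "w \<in> W'" "x \<in> B" by auto
      have "lie v w \<in> cvec.span W'"
        using v(1)[OF wx(2)] by (subst lie_anti) (rule cvec.span_neg)
      then have "lie (lie v w) x \<in> C" using span_C wx(3) by blast
      moreover have "lie w (lie v x) \<in> C"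
        unfolding C_def using wx vB by (intro action_span_base(2))
      ultimately show ?thesis
        unfolding wx(1) lie_derivation[of v w x] using C(3) by (intro cvec.subspace_add)
    qed
  qed
  show "action_span W'' A B \<noteq> B"
  proof
    assume eq: "action_span W'' A B = B"
    define D where "D = {c + y |c y. c \<in> C \<and> y \<in> lie v ` B}"
    have "cvec.subspace D"
      unfolding D_def
      using linear_endo_lie[of v, unfolded linear_iff_module_hom] subB
      by (intro cvec.subspace_sums C(3) module_hom.subspace_image)
    moreover have "A \<union> {lie w x | w x. w \<in> W'' \<and> x \<in> B} \<subseteq> D"
    proof (intro Un_least subsetI)
      fix y assume "y \<in> A"
      then have "y \<in> C" unfolding C_def by (rule action_span_base)
      moreover have "y = y + lie v 0" "lie v 0 \<in> lie v ` B"
        using subB by (simp, intro imageI cvec.subspace_0)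
      ultimately show "y \<in> D" unfolding D_def by blast
    next
      fix y assume "y \<in> {lie w x | w x. w \<in> W'' \<and> x \<in> B}"
      then obtain w x where wx: "y = lie w x" "w \<in> W''" "x \<in> B" by auto
      then have "w \<in> cvec.span (insert v W')" using W''(3) by blast
      then obtain k where k: "w - k *\<^sub>C v \<in> cvec.span W'"
        unfolding cvec.span_breakdown_eq by blast
      have "y = lie (w - k *\<^sub>C v) x + lie v (k *\<^sub>C x)"
        by (simp add: wx lie_diff_left lie_cscale_left lie_cscale_right)
      moreover have "k *\<^sub>C x \<in> B" using wx(3) subB by (simp add: cvec.subspace_scale)
      moreover have "lie (w - k *\<^sub>C v) x \<in> C" using span_C k wx(3) by blast
      ultimately show "y \<in> D" unfolding D_def by (intro CollectI exI conjI imageI) auto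
    qed
    ultimately have "action_span W'' A B \<subseteq> D"
      unfolding action_span_def by (rule cvec.span_minimal[rotated])
    have step: "\<exists>c\<in>C. \<exists>y\<in>B. x = c + lie v y" if "x \<in> B" for x
    proof -
      have "x \<in> D" using that \<open>action_span W'' A B \<subseteq> D\<close> eq by blast
      then show ?thesis unfolding D_def by blast
    qed
    have "\<exists>c\<in>C. \<exists>y\<in>B. x = c + (lie v ^^ m) y" if "x \<in> B" for x m
      using that
    proof (induction m arbitrary: x)
      case 0
      then show ?case using C(3) cvec.subspace_0 by force
    next
      case (Suc m)
      obtain c y where cy: "c \<in> C" "y \<in> B" "x = c + lie v y" using step Suc.prems by blast
      obtain c' y' where cy': "c' \<in> C" "y' \<in> B" "y = c' + (lie v ^^ m) y'"
        using Suc.IH cy(2) by blast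
      have "x = (c + lie v c') + (lie v ^^ Suc m) y'"
        by (simp add: cy(3) cy'(3) lie_add_right add.assoc)
      then show ?case using cy(1) cy'(1,2) vC C(3) cvec.subspace_add by blast
    qed
    from this[of _ n] have "B \<subseteq> C" unfolding v(2) by auto
    then show False using C by blast
  qed
qed

lemma finite_spanning_subset:
  obtains D :: "'g::complex_lie_algebra set"
  where "finite D" "D \<subseteq> V" "cvec.independent D" "V \<subseteq> cvec.span D"
proof -
  obtain F :: "'g set" where F: "finite F" "\<And>x. \<exists>k. x = (\<Sum>b\<in>F. k b *\<^sub>C b)"
    using cfinite_dim by blast
  have "cvec.span F = UNIV"
    using F(2) cvec.span_finite[OF F(1)] by (auto simp: image_iff)
  moreover obtain D where D: "D \<subseteq> V" "cvec.independent D" "V \<subseteq> cvec.span D"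
    using cvec.maximal_independent_subset by blast
  ultimately have "finite D" using cvec.independent_span_bound[OF F(1) D(2)] by auto
  then show ?thesis using that D by blast
qed

text \<open>Among the weakly closed shrinking subsets choose one with span of maximal dimension. If
  it does not span \<open>W\<close>, then a stable subspace that is minimal among those containing its span
  and an element \<open>v\<close> of \<open>W\<close> outside yields an element to which \<open>shrinking_extend\<close> applies.\<close>

lemma weakly_closed_nilpotent_shrinking:
  fixes W :: "'g::complex_lie_algebra set"
  assumes closed: "lie_closed W" and nil: "\<And>w. w \<in> W \<Longrightarrow> \<exists>n. \<forall>x. (lie w ^^ n) x = 0"
  shows "shrinking W"
proof -
  obtain E :: "'g set" where E: "finite E" "cvec.independent E" "UNIV \<subseteq> cvec.span E"
    using finite_spanning_subset by metis
  interpret fd: finite_dimensional_vector_space "cscale :: complex \<Rightarrow> 'g \<Rightarrow> 'g" E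
    using E by unfold_locales auto
  define good where "good W' \<longleftrightarrow> W' \<subseteq> W \<and> lie_closed W' \<and> shrinking W'" for W'
  have "good {}"
    unfolding good_def lie_closed_def shrinking_def action_span_def lie_stable_def
    by (simp add: cvec.span_eq_iff[THEN iffD2] psubset_eq)
  then obtain W' where W': "good W'"
    and max: "\<And>W''. good W'' \<Longrightarrow> cvec.dim W'' \<le> cvec.dim W'"
    using ex_has_greatest_nat[of good "{}" cvec.dim "Suc fd.dimension"] fd.dim_subset_UNIV
    by (auto simp: less_Suc_eq_le)
  have W'2: "W' \<subseteq> W" "lie_closed W'" "shrinking W'" using W' by (auto simp: good_def)
  have span_stable: "lie_stable W' (cvec.span X)" if "W' \<subseteq> W" "X = W \<or> X = W'" for X
    unfolding lie_stable_def
  proof (intro conjI ballI)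
    fix w x assume w: "w \<in> W'" and x: "x \<in> cvec.span X"
    show "lie w x \<in> cvec.span X"
      using x by (rule act_on_span_in_subspace)
        (use w that closed W'2(2) in \<open>auto simp: lie_closed_def intro!: cvec.span_base\<close>)
  qed simp
  have "W \<subseteq> cvec.span W'"
  proof (rule ccontr)
    assume not: "\<not> W \<subseteq> cvec.span W'"
    let ?A = "cvec.span W'"
    define P where "P V \<longleftrightarrow> lie_stable W' V \<and> ?A \<subseteq> V \<and> \<not> V \<inter> W \<subseteq> ?A" for V
    have "P (cvec.span W)"
      unfolding P_def
      using not span_stable[OF W'2(1), of W] cvec.span_mono[OF W'2(1)] cvec.span_superset[of W]
      by blast
    then obtain V where V: "P V" and min: "\<And>V'. P V' \<Longrightarrow> cvec.dim V \<le> cvec.dim V'"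
      using ex_has_least_nat[of P "cvec.span W" cvec.dim] by auto
    let ?V' = "action_span W' ?A V"
    have sub: "?V' \<subseteq> V" "lie_stable W' ?V'" "cvec.subspace V"
      using V action_span_subset[of W' V ?A] action_span_stable[of W' V ?A]
      by (auto simp: P_def lie_stable_def)
    have "?A \<subset> V" using V by (auto simp: P_def)
    then have "?V' \<noteq> V"
      using W'2(3) V span_stable[OF W'2(1), of W'] by (auto simp: shrinking_def P_def)
    then have "cvec.dim ?V' < cvec.dim V"
      using sub(1,3) subspace_action_span[of W' ?A V]
      by (intro fd.dim_psubset) (simp add: cvec.span_eq_iff[THEN iffD2] psubset_eq)
    then have "\<not> P ?V'" using min by (meson leD)
    then have V'W: "?V' \<inter> W \<subseteq> ?A"
      using sub(2) action_span_base(1)[of _ ?A W' V] unfolding P_def by blast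
    obtain v where v: "v \<in> V" "v \<in> W" "v \<notin> ?A" using V by (auto simp: P_def)
    have vA: "lie w v \<in> ?A" if "w \<in> W'" for w
    proof -
      have "lie w v \<in> W" using that v(2) W'2(1) closed by (auto simp: lie_closed_def)
      moreover have "lie w v \<in> ?V'" using that v(1) by (rule action_span_base)
      ultimately show ?thesis using V'W by blast
    qed
    define W'' where "W'' = W \<inter> cvec.span (insert v W')"
    have sub'': "W' \<subseteq> W''" "v \<in> W''"
      using W'2(1) v(2) by (auto simp: W''_def intro: cvec.span_base)
    have AA: "lie x y \<in> ?A" if "x \<in> ?A" "y \<in> ?A" for x y
      using that(1) cvec.subspace_span
      by (rule span_act_in_subspace)
        (use that(2) span_stable[OF W'2(1), of W'] in \<open>auto simp: lie_stable_def\<close>)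
    have "lie_closed W''"
      unfolding lie_closed_def
    proof (intro ballI)
      fix x y assume xy: "x \<in> W''" "y \<in> W''"
      then have "x \<in> cvec.span (insert v W')" "y \<in> cvec.span (insert v W')"
        by (auto simp: W''_def)
      then obtain k m where k: "x - k *\<^sub>C v \<in> ?A" and m: "y - m *\<^sub>C v \<in> ?A"
        unfolding cvec.span_breakdown_eq by blast
      let ?x = "x - k *\<^sub>C v" and ?y = "y - m *\<^sub>C v"
      have Av: "lie z v \<in> ?A" if "z \<in> ?A" for z
        using that by (rule span_act_in_subspace) (simp_all add: vA)
      have "lie x y = lie ?x ?y + (m *\<^sub>C lie ?x v - k *\<^sub>C lie ?y v)"
      proof -
        have "lie x y = lie (?x + k *\<^sub>C v) (?y + m *\<^sub>C v)" by simp
        also have "\<dots> = lie ?x ?y + (m *\<^sub>C lie ?x v + k *\<^sub>C lie v ?y)"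
          unfolding lie_add_left lie_add_right lie_cscale_left lie_cscale_right
          by (simp add: lie_self algebra_simps)
        also have "lie v ?y = - lie ?y v" by (rule lie_anti)
        finally show ?thesis by simp
      qed
      also have "\<dots> \<in> ?A"
        by (intro cvec.span_add cvec.span_diff cvec.span_scale AA[OF k m] Av[OF k] Av[OF m])
      finally have "lie x y \<in> ?A" .
      moreover have "?A \<subseteq> cvec.span (insert v W')" by (intro cvec.span_mono) auto
      ultimately show "lie x y \<in> W''"
        using xy closed by (auto simp: W''_def lie_closed_def)
    qed
    moreover have "shrinking W''"
    proof -
      obtain n where "\<forall>x. (lie v ^^ n) x = 0" using nil[OF v(2)] ..
      then show ?thesis
        by (intro shrinking_extend[OF W'2(3,2), of v n] vA sub'') (auto simp: W''_def)
    qed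
    ultimately have "good W''" by (simp add: good_def W''_def)
    moreover have "cvec.dim W' < cvec.dim W''"
    proof (rule fd.dim_psubset)
      show "cvec.span W' \<subset> cvec.span W''"
        using cvec.span_mono[OF sub''(1)] cvec.span_base[OF sub''(2)] v(3) by blast
    qed
    ultimately show False using max by (meson leD)
  qed
  show ?thesis
    unfolding shrinking_def
  proof (intro allI impI, elim conjE)
    fix A B assume A: "lie_stable W A" and B: "lie_stable W B" and AB: "A \<subset> B"
    have AB': "lie_stable W' A" "lie_stable W' B"
      using A B W'2(1) by (auto simp: lie_stable_def)
    have "action_span W A B \<subseteq> action_span W' A B"
      unfolding action_span_def[of W]
    proof (rule cvec.span_minimal[OF _ subspace_action_span], intro Un_least subsetI)
      fix y assume "y \<in> {lie w x | w x. w \<in> W \<and> x \<in> B}"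
      then obtain w x where wx: "y = lie w x" "w \<in> W" "x \<in> B" by auto
      have "w \<in> cvec.span W'" using wx(2) \<open>W \<subseteq> cvec.span W'\<close> by blast
      then show "y \<in> action_span W' A B"
        unfolding wx(1) using subspace_action_span
        by (rule span_act_in_subspace) (auto intro: action_span_base wx(3))
    qed (auto intro: action_span_base)
    moreover have "action_span W' A B \<subset> B"
      using W'2(3) AB AB' action_span_subset[OF AB'(2)] by (auto simp: shrinking_def)
    ultimately show "action_span W A B \<noteq> B" by blast
  qed
qed

section \<open>A basis of weight vectors\<close>

text \<open>An eigenvector shared by all operators in \<open>S\<close> splits into eigenvectors of one further operator \<open>H\<close>.
  As the operators commute, each part has the same eigenvalues under \<open>S\<close>, by the independence of
  eigenspaces of \<open>H\<close>.\<close>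

lemma joint_eigenvectors_span:
  fixes S :: "'g::complex_lie_algebra set"
  assumes "finite S" "\<And>H H'. H \<in> S \<Longrightarrow> H' \<in> S \<Longrightarrow> lie H H' = 0"
    "\<And>H. H \<in> S \<Longrightarrow> diagonalizable (lie H)"
  shows "cvec.span {x. \<forall>H\<in>S. \<exists>c. lie H x = c *\<^sub>C x} = UNIV"
  using assms
proof (induction S rule: finite_induct)
  case empty
  then show ?case by simp
next
  case (insert H S)
  let ?E' = "{x. \<forall>H\<in>S. \<exists>c. lie H x = c *\<^sub>C x}"
  let ?E = "{x. \<forall>H\<in>insert H S. \<exists>c. lie H x = c *\<^sub>C x}"
  obtain D where D: "cvec.span D = UNIV" "\<forall>X\<in>D. \<exists>c. lie H X = c *\<^sub>C X"
    using insert.prems(2)[of H] unfolding diagonalizable_def by blast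
  obtain \<mu> where \<mu>: "\<And>X. X \<in> D \<Longrightarrow> lie H X = \<mu> X *\<^sub>C X" using D(2) by metis
  have "?E' \<subseteq> cvec.span ?E"
  proof
    fix x assume x: "x \<in> ?E'"
    then obtain c where c: "\<And>K. K \<in> S \<Longrightarrow> lie K x = c K *\<^sub>C x" by simp metis
    have "x \<in> cvec.span D" using D(1) by simp
    then obtain t k where t: "finite t" "t \<subseteq> D" "x = (\<Sum>b\<in>t. k b *\<^sub>C b)"
      unfolding cvec.span_explicit by blast
    define y where "y m = (\<Sum>b | b \<in> t \<and> \<mu> b = m. k b *\<^sub>C b)" for m
    have Hy: "lie H (y m) = m *\<^sub>C y m" for m
      unfolding y_def lie_sum_right cvec.scale_sum_right
      by (rule sum.cong[OF refl])
        (use t(2) in \<open>auto simp: lie_cscale_right \<mu> subsetD cvec.scale_left_commute\<close>)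
    have xy: "x = (\<Sum>m\<in>\<mu> ` t. y m)"
      unfolding t(3) y_def by (rule sum.image_gen[OF t(1)])
    have "y m \<in> ?E" if m: "m \<in> \<mu> ` t" for m
    proof -
      have "lie K (y m) = c K *\<^sub>C y m" if K: "K \<in> S" for K
      proof -
        have HK: "lie H (lie K z) = lie K (lie H z)" for z
          using lie_derivation[of H K z] insert.prems(1)[of H K] K by simp
        have "lie K (y m) - c K *\<^sub>C y m \<in> {0}"
        proof (rule weight_components_in_invariant_subspace[where I = "\<mu> ` t" and S = "{H}"
              and w = "\<lambda>m _. m" and x = "\<lambda>m. lie K (y m) - c K *\<^sub>C y m"])
          have "(\<Sum>m\<in>\<mu> ` t. lie K (y m) - c K *\<^sub>C y m) = lie K x - c K *\<^sub>C x"
            by (simp add: xy lie_sum_right sum_subtractf cvec.scale_sum_right)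
          then show "(\<Sum>m\<in>\<mu> ` t. lie K (y m) - c K *\<^sub>C y m) \<in> {0}" using c[OF K] by simp
        qed (use t m HK Hy in \<open>auto simp: lie_diff_right lie_cscale_right
              cvec.scale_right_diff_distrib cvec.scale_left_commute\<close>)
        then show ?thesis by simp
      qed
      then show ?thesis using Hy by auto
    qed
    then show "x \<in> cvec.span ?E" unfolding xy by (intro cvec.span_sum cvec.span_base)
  qed
  then have "cvec.span ?E' \<subseteq> cvec.span ?E" by (intro cvec.span_minimal) auto
  moreover have "cvec.span ?E' = UNIV" using insert.IH insert.prems by simp
  ultimately show ?case by blast
qed

lemma weight_basis_exists:
  fixes \<aa> :: "'g::complex_lie_algebra set"
  assumes "cartan_subalgebra \<aa>"
  obtains B where "finite B" "cvec.independent B" "cvec.span B = UNIV"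
    "\<And>b H. b \<in> B \<Longrightarrow> H \<in> \<aa> \<Longrightarrow> \<exists>c. lie H b = c *\<^sub>C b"
proof -
  obtain D where D: "finite D" "D \<subseteq> \<aa>" "cvec.independent D" "\<aa> \<subseteq> cvec.span D"
    by (rule finite_spanning_subset)
  let ?E = "{x. \<forall>H\<in>D. \<exists>c. lie H x = c *\<^sub>C x}"
  have E: "cvec.span ?E = UNIV"
    using D(1)
  proof (rule joint_eigenvectors_span)
    show "lie H H' = 0" if "H \<in> D" "H' \<in> D" for H H'
    proof -
      have "H \<in> \<aa>" "H' \<in> \<aa>" using that D(2) by auto
      then show ?thesis using assms unfolding cartan_subalgebra_def abelian_subalgebra_def by metis
    qed
    show "diagonalizable (lie H)" if "H \<in> D" for H
      using that D(2) assms unfolding cartan_subalgebra_def by blast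
  qed
  obtain B where B: "finite B" "B \<subseteq> ?E" "cvec.independent B" "?E \<subseteq> cvec.span B"
    by (rule finite_spanning_subset)
  have "\<exists>c. lie H b = c *\<^sub>C b" if bH: "b \<in> B" "H \<in> \<aa>" for b H
  proof -
    have "H \<in> cvec.span D" using bH(2) D(4) by blast
    then show ?thesis
    proof (induction rule: cvec.span_induct_alt)
      case base
      show ?case by (intro exI[of _ 0]) simp
    next
      case (step c K H)
      then obtain c1 c2 where "lie K b = c1 *\<^sub>C b" "lie H b = c2 *\<^sub>C b" using bH(1) B(2) by blast
      then have "lie (c *\<^sub>C K + H) b = (c * c1 + c2) *\<^sub>C b"
        by (simp add: lie_add_left lie_cscale_left cvec.scale_left_distrib)
      then show ?case ..
    qed
  qed
  moreover have "cvec.span B = UNIV"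
    using cvec.span_minimal[OF B(4)] E by auto
  ultimately show ?thesis using that B by blast
qed

text \<open>Roots are linear forms on the whole algebra, whereas the eigenvalues on a weight vector are
  only defined on \<open>\<aa>\<close>. They are extended by means of the projection \<open>cartan_part\<close> along the
  root spaces, which uses coordinates with respect to a fixed basis of weight vectors.\<close>

locale root_decomposition =
  fixes \<aa> B :: "'g::complex_lie_algebra set"
  assumes semisimple: "semisimple_lie_algebra TYPE('g)"
    and cartan: "cartan_subalgebra \<aa>"
    and finite_B: "finite B"
    and independent_B: "cvec.independent B"
    and span_B: "cvec.span B = UNIV"
    and eigenvectors: "\<And>b H. b \<in> B \<Longrightarrow> H \<in> \<aa> \<Longrightarrow> \<exists>c. lie H b = c *\<^sub>C b"
begin

abbreviation coord :: "'g \<Rightarrow> 'g \<Rightarrow> complex" where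
  "coord \<equiv> cvec.representation B"

lemma in_span_B [simp]: "x \<in> cvec.span B"
  using span_B by simp

lemma coord_add [simp]: "coord (x + y) b = coord x b + coord y b"
  by (subst cvec.representation_add[OF independent_B]) auto

lemma coord_scale [simp]: "coord (c *\<^sub>C x) b = c * coord x b"
  by (subst cvec.representation_scale[OF independent_B]) auto

lemma coord_diff [simp]: "coord (x - y) b = coord x b - coord y b"
  by (subst cvec.representation_diff[OF independent_B]) auto

lemma coord_0 [simp]: "coord 0 b = 0"
  by (simp add: cvec.representation_zero)

lemma coord_sum: "coord (\<Sum>i\<in>I. f i) b = (\<Sum>i\<in>I. coord (f i) b)"
  by (induction I rule: infinite_finite_induct) simp_all

lemma coord_basis: "b \<in> B \<Longrightarrow> coord b b' = (if b' = b then 1 else 0)"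
  by (subst cvec.representation_basis[OF independent_B]) auto

lemma basis_expansion: "x = (\<Sum>b\<in>B. coord x b *\<^sub>C b)"
  by (rule cvec.sum_representation_eq[OF independent_B, symmetric]) (auto simp: finite_B)

lemma coord_combination:
  assumes "B' \<subseteq> B" "b \<in> B"
  shows "coord (\<Sum>b\<in>B'. k b *\<^sub>C b) b = (if b \<in> B' then k b else 0)"
proof -
  have "coord (\<Sum>b\<in>B'. k b *\<^sub>C b) b = (\<Sum>b'\<in>B'. if b' = b then k b' else 0)"
    unfolding coord_sum by (rule sum.cong) (use assms in \<open>auto simp: coord_basis\<close>)
  also have "\<dots> = (if b \<in> B' then k b else 0)"
    using finite_subset[OF assms(1) finite_B] by simp
  finally show ?thesis .
qed

lemma coord_eqI: "(\<And>b. b \<in> B \<Longrightarrow> coord x b = coord y b) \<Longrightarrow> x = y"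
  by (subst (1 2) basis_expansion) (rule sum.cong, auto)

lemma in_span_iff_coord:
  assumes "B' \<subseteq> B"
  shows "x \<in> cvec.span B' \<longleftrightarrow> (\<forall>b\<in>B - B'. coord x b = 0)"
proof
  assume "x \<in> cvec.span B'"
  then show "\<forall>b\<in>B - B'. coord x b = 0"
    by (induction rule: cvec.span_induct_alt) (use assms in \<open>auto simp: coord_basis\<close>)
next
  assume 0: "\<forall>b\<in>B - B'. coord x b = 0"
  have "x = (\<Sum>b\<in>B'. coord x b *\<^sub>C b)"
    by (subst basis_expansion) (rule sum.mono_neutral_right, use assms 0 finite_B in auto)
  also have "\<dots> \<in> cvec.span B'" by (intro cvec.span_sum cvec.span_scale cvec.span_base)
  finally show "x \<in> cvec.span B'" .
qed

lemma quot_basis_complement: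
  assumes "B' \<subseteq> B"
  shows quot_basis_span: "quot_basis (cvec.span B') (B - B')"
    and quot_coord_span: "b \<in> B - B' \<Longrightarrow> quot_coord (cvec.span B') (B - B') y b = coord y b"
proof -
  have iff: "quot_coeffs (cvec.span B') (B - B') y c \<longleftrightarrow>
      c = (\<lambda>b. if b \<in> B - B' then coord y b else 0)" for y c
    unfolding quot_coeffs_def in_span_iff_coord[OF assms]
    by (auto simp: coord_combination fun_eq_iff)
  show "quot_basis (cvec.span B') (B - B')"
    unfolding quot_basis_def iff using finite_B by simp
  from quot_coord_eqI[OF this, of y "\<lambda>b. if b \<in> B - B' then coord y b else 0"]
  show "b \<in> B - B' \<Longrightarrow> quot_coord (cvec.span B') (B - B') y b = coord y b"
    unfolding iff by simp
qed

lemma endo_trace_coord: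
  assumes "linear_endo A"
  shows "endo_trace A = (\<Sum>b\<in>B. coord (A b) b)"
proof -
  interpret A: Vector_Spaces.linear "(*\<^sub>C)" "(*\<^sub>C)" A by (rule assms)
  have "A ` {0} \<subseteq> {0}" by (simp add: A.zero)
  then have "endo_trace A = (\<Sum>b\<in>B. quot_coord {0} B (A b) b)"
    unfolding endo_trace_def
    using quot_basis_span[of "{}"] assms \<open>A ` {0} \<subseteq> {0}\<close>
    by (intro quot_trace_eq) simp_all
  then show ?thesis using quot_coord_span[of "{}"] by simp
qed

subsection \<open>The Cartan subalgebra and the weights\<close>

lemma subspace_cartan: "cvec.subspace \<aa>"
  and cartan_commute: "H \<in> \<aa> \<Longrightarrow> H' \<in> \<aa> \<Longrightarrow> lie H H' = 0"
  using cartan by (auto simp: cartan_subalgebra_def abelian_subalgebra_def)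

text \<open>Adjoining \<open>x\<close> to \<open>\<aa>\<close> would give a larger abelian subalgebra.\<close>

lemma centralizer_cartan:
  assumes x: "\<And>H. H \<in> \<aa> \<Longrightarrow> lie H x = 0"
  shows "x \<in> \<aa>"
proof -
  let ?b = "cvec.span (insert x \<aa>)"
  have 1: "lie u y = 0" if "u \<in> insert x \<aa>" "y \<in> ?b" for u y
  proof -
    have "lie u y \<in> {0}"
      using that(2) cvec.subspace_single_0
    proof (rule act_on_span_in_subspace)
      fix z assume z: "z \<in> insert x \<aa>"
      have "lie x z = 0" if "z \<in> \<aa>" using x[OF that] lie_anti[of x z] by simp
      then show "lie u z \<in> {0}"
        using z that(1) x cartan_commute by (auto simp: lie_self)
    qed
    then show ?thesis by simp
  qed
  have "lie y z = 0" if "y \<in> ?b" "z \<in> ?b" for y z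
    using span_act_in_subspace[OF that(1) cvec.subspace_single_0, of z] 1[OF _ that(2)] by auto
  then have "abelian_subalgebra ?b" by (auto simp: abelian_subalgebra_def)
  moreover have "\<aa> \<subseteq> ?b" by (auto intro: cvec.span_base)
  ultimately have "?b = \<aa>" using cartan by (auto simp: cartan_subalgebra_def)
  then show ?thesis using cvec.span_base[of x "insert x \<aa>"] by auto
qed

definition eigval :: "'g \<Rightarrow> 'g \<Rightarrow> complex" where
  "eigval b H = (SOME c. lie H b = c *\<^sub>C b)"

lemma lie_eigval: "b \<in> B \<Longrightarrow> H \<in> \<aa> \<Longrightarrow> lie H b = eigval b H *\<^sub>C b"
  unfolding eigval_def by (rule someI_ex) (rule eigenvectors)

lemma basis_nonzero: "b \<in> B \<Longrightarrow> b \<noteq> 0"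
  using independent_B cvec.dependent_zero by blast

lemma eigval_eqI: "b \<in> B \<Longrightarrow> H \<in> \<aa> \<Longrightarrow> lie H b = c *\<^sub>C b \<Longrightarrow> eigval b H = c"
  using lie_eigval[of b H] basis_nonzero by (metis cvec.scale_cancel_right)

lemma coord_lie_cartan_eigval:
  assumes "H \<in> \<aa>" "b \<in> B"
  shows "coord (lie H x) b = eigval b H * coord x b"
proof -
  have "lie H x = (\<Sum>b\<in>B. (coord x b * eigval b H) *\<^sub>C b)"
    by (subst basis_expansion[of x], unfold lie_sum_right, rule sum.cong)
       (use assms in \<open>auto simp: lie_cscale_right lie_eigval\<close>)
  then show ?thesis using coord_combination[OF subset_refl assms(2)] assms(2) by simp
qed

lemma basis_in_cartan_iff: "b \<in> B \<Longrightarrow> b \<in> \<aa> \<longleftrightarrow> (\<forall>H\<in>\<aa>. eigval b H = 0)"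
  using lie_eigval[of b] cartan_commute centralizer_cartan[of b] eigval_eqI[of b _ 0]
  by (metis cvec.scale_zero_left)

definition cartan_part :: "'g \<Rightarrow> 'g" where
  "cartan_part x = (\<Sum>b\<in>B \<inter> \<aa>. coord x b *\<^sub>C b)"

lemma cartan_part_add: "cartan_part (x + y) = cartan_part x + cartan_part y"
  by (simp add: cartan_part_def cvec.scale_left_distrib sum.distrib)

lemma cartan_part_scale: "cartan_part (c *\<^sub>C x) = c *\<^sub>C cartan_part x"
  by (simp add: cartan_part_def cvec.scale_sum_right)

lemma cartan_part_in: "cartan_part x \<in> \<aa>"
  unfolding cartan_part_def
  by (intro cvec.subspace_sum subspace_cartan cvec.subspace_scale) auto

lemma cartan_part_id: "H \<in> \<aa> \<Longrightarrow> cartan_part H = H"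
proof -
  assume H: "H \<in> \<aa>"
  have "coord H b = 0" if b: "b \<in> B - \<aa>" for b
  proof -
    obtain H' where H': "H' \<in> \<aa>" "eigval b H' \<noteq> 0" using b basis_in_cartan_iff by blast
    have "eigval b H' * coord H b = 0"
      using coord_lie_cartan_eigval[OF H'(1), of b H] cartan_commute[OF H'(1) H] b by simp
    then show ?thesis using H'(2) by simp
  qed
  then show ?thesis
    unfolding cartan_part_def
    by (subst (2) basis_expansion) (rule sum.mono_neutral_left, use finite_B in auto)
qed

definition wt :: "'g \<Rightarrow> 'g \<Rightarrow> complex" where
  "wt b X = eigval b (cartan_part X)"

lemma lie_wt: "b \<in> B \<Longrightarrow> H \<in> \<aa> \<Longrightarrow> lie H b = wt b H *\<^sub>C b"
  by (simp add: wt_def cartan_part_id lie_eigval)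

lemma coord_lie_cartan:
  "H \<in> \<aa> \<Longrightarrow> b \<in> B \<Longrightarrow> coord (lie H x) b = wt b H * coord x b"
  by (simp add: wt_def cartan_part_id coord_lie_cartan_eigval)

lemma linear_form_wt: "b \<in> B \<Longrightarrow> linear_form (wt b)"
proof (rule linear_formI)
  assume b: "b \<in> B"
  fix x y c
  show "wt b (x + y) = wt b x + wt b y"
    unfolding wt_def cartan_part_add
    by (rule eigval_eqI[OF b]) (simp_all add: cartan_part_in lie_add_left lie_eigval[OF b]
        cvec.scale_left_distrib cvec.subspace_add[OF subspace_cartan])
  show "wt b (c *\<^sub>C x) = c * wt b x"
    unfolding wt_def cartan_part_scale
    by (rule eigval_eqI[OF b]) (simp_all add: cartan_part_in lie_cscale_left lie_eigval[OF b]
        cvec.subspace_scale[OF subspace_cartan])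
qed

lemma wt_zero_iff: "b \<in> B \<Longrightarrow> wt b = (\<lambda>_. 0) \<longleftrightarrow> b \<in> \<aa>"
  unfolding basis_in_cartan_iff fun_eq_iff wt_def
  using cartan_part_in cartan_part_id by metis

lemma root_space_coord:
  assumes "x \<in> root_space \<aa> \<nu>" "b \<in> B" "coord x b \<noteq> 0" "H \<in> \<aa>"
  shows "wt b H = \<nu> H"
proof -
  have "lie H x = \<nu> H *\<^sub>C x" using assms by (simp add: root_space_def)
  then have "wt b H * coord x b = \<nu> H * coord x b"
    using coord_lie_cartan[OF assms(4,2), of x] by (simp only: coord_scale)
  then show ?thesis using assms(3) by simp
qed

lemma wt_cartan_form:
  assumes b: "b \<in> B"
  shows "wt b \<in> cartan_forms \<aa>"
  unfolding cartan_forms_def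
proof (intro CollectI conjI allI impI ballI, rule linear_form_wt[OF b], elim conjE bexE)
  fix \<nu> x H
  assume \<nu>: "H \<in> \<aa>" "\<nu> H \<noteq> 0" "x \<in> root_space \<aa> \<nu>"
  have "coord x b' = 0" if "b' \<in> B \<inter> \<aa>" for b'
    using root_space_coord[OF \<nu>(3) _ _ \<nu>(1), of b'] wt_zero_iff[of b'] \<nu>(2) that by fastforce
  then have "cartan_part x = cartan_part 0" by (simp add: cartan_part_def)
  then show "wt b x = 0"
    using linear_form_0[OF linear_form_wt[OF b]] by (simp add: wt_def)
qed

lemma basis_in_root_space: "b \<in> B \<Longrightarrow> b \<in> root_space \<aa> (wt b)"
  by (simp add: root_space_def lie_wt)

lemma cartan_form_eq_cartan_part:
  assumes f: "f \<in> cartan_forms \<aa>"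
  shows "f x = f (cartan_part x)"
proof -
  have lin: "linear_form f" using f by (simp add: cartan_forms_def)
  have 0: "f b = 0" if b: "b \<in> B - \<aa>" for b
  proof -
    have "\<exists>H\<in>\<aa>. wt b H \<noteq> 0"
      using b basis_in_cartan_iff[of b] by (auto simp: wt_def cartan_part_id)
    then show ?thesis
      using f b linear_form_wt[of b] basis_in_root_space[of b]
      unfolding cartan_forms_def by blast
  qed
  have "f x = (\<Sum>b\<in>B. coord x b * f b)"
    by (subst basis_expansion) (simp add: linear_form_sum[OF lin] linear_form_scale[OF lin])
  also have "\<dots> = (\<Sum>b\<in>B \<inter> \<aa>. coord x b * f b)"
    by (rule sum.mono_neutral_right) (use finite_B 0 in auto)
  also have "\<dots> = f (cartan_part x)"
    by (simp add: cartan_part_def linear_form_sum[OF lin] linear_form_scale[OF lin])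
  finally show ?thesis .
qed

lemma cartan_form_ext:
  assumes "f \<in> cartan_forms \<aa>" "g \<in> cartan_forms \<aa>" "\<And>H. H \<in> \<aa> \<Longrightarrow> f H = g H"
  shows "f = g"
  using assms cartan_form_eq_cartan_part cartan_part_in by (intro ext) metis

lemma cartan_form_linear: "f \<in> cartan_forms \<aa> \<Longrightarrow> linear_form f"
  by (simp add: cartan_forms_def)

lemma cartan_form_0: "(\<lambda>_. 0) \<in> cartan_forms \<aa>"
  by (auto simp: cartan_forms_def intro!: linear_formI)

lemma cartan_form_add:
  "f \<in> cartan_forms \<aa> \<Longrightarrow> g \<in> cartan_forms \<aa> \<Longrightarrow> (\<lambda>X. f X + g X) \<in> cartan_forms \<aa>"
  by (auto simp: cartan_forms_def linear_form_add linear_form_scale algebra_simps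
      intro!: linear_formI)

lemma cartan_form_scale:
  "f \<in> cartan_forms \<aa> \<Longrightarrow> (\<lambda>X. c * f X) \<in> cartan_forms \<aa>"
  by (auto simp: cartan_forms_def linear_form_add linear_form_scale algebra_simps
      intro!: linear_formI)

lemma cartan_form_minus:
  "f \<in> cartan_forms \<aa> \<Longrightarrow> (\<lambda>X. - f X) \<in> cartan_forms \<aa>"
  using cartan_form_scale[of f "-1"] by simp

lemma cartan_form_diff:
  "f \<in> cartan_forms \<aa> \<Longrightarrow> g \<in> cartan_forms \<aa> \<Longrightarrow> (\<lambda>X. f X - g X) \<in> cartan_forms \<aa>"
  using cartan_form_add[OF _ cartan_form_minus, of f g] by simp

lemma cartan_form_sum:
  "(\<And>i. i \<in> I \<Longrightarrow> f i \<in> cartan_forms \<aa>) \<Longrightarrow> (\<lambda>X. \<Sum>i\<in>I. f i X) \<in> cartan_forms \<aa>"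
  by (induction I rule: infinite_finite_induct) (simp_all add: cartan_form_0 cartan_form_add)

lemma root_space_wt:
  assumes "x \<in> root_space \<aa> \<nu>" "\<nu> \<in> cartan_forms \<aa>" "b \<in> B" "coord x b \<noteq> 0"
  shows "wt b = \<nu>"
  using assms by (intro cartan_form_ext wt_cartan_form) (auto intro: root_space_coord)

lemma root_space_nonzero_wt:
  assumes "x \<in> root_space \<aa> \<nu>" "\<nu> \<in> cartan_forms \<aa>" "x \<noteq> 0"
  obtains b where "b \<in> B" "coord x b \<noteq> 0" "wt b = \<nu>"
proof -
  obtain b where "b \<in> B" "coord x b \<noteq> 0" using assms(3) coord_eqI[of x 0] by auto
  then show ?thesis using root_space_wt[OF assms(1,2)] that by blast
qed

lemma subspace_root_space: "cvec.subspace (root_space \<aa> \<nu>)"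
  unfolding root_space_def cvec.subspace_def
  by (auto simp: lie_add_right lie_cscale_right cvec.scale_right_distrib cvec.scale_left_commute)

lemma lie_root_space:
  "x \<in> root_space \<aa> \<mu> \<Longrightarrow> y \<in> root_space \<aa> \<nu> \<Longrightarrow> lie x y \<in> root_space \<aa> (\<lambda>X. \<mu> X + \<nu> X)"
  unfolding root_space_def
  by (auto simp: lie_derivation[of _ x y] lie_cscale_left lie_cscale_right cvec.scale_left_distrib)

lemma root_space_zero: "root_space \<aa> (\<lambda>_. 0) = \<aa>"
  using cartan_commute centralizer_cartan by (auto simp: root_space_def)

lemma lie_root_space_opposite:
  "x \<in> root_space \<aa> \<mu> \<Longrightarrow> y \<in> root_space \<aa> (\<lambda>X. - \<mu> X) \<Longrightarrow> lie x y \<in> \<aa>"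
  using lie_root_space[of x \<mu> y "\<lambda>X. - \<mu> X"] by (simp add: root_space_zero)

lemma lie_funpow_root_space:
  assumes "x \<in> root_space \<aa> \<mu>" "y \<in> root_space \<aa> \<nu>"
  shows "(lie x ^^ n) y \<in> root_space \<aa> (\<lambda>X. \<nu> X + of_nat n * \<mu> X)"
proof (induction n)
  case (Suc n)
  show ?case using lie_root_space[OF assms(1) Suc.IH] by (simp add: algebra_simps)
qed (simp add: assms)

text \<open>The weights \<open>\<beta> + n * \<alpha>\<close> are pairwise distinct, so all but finitely many of their weight spaces
  are zero.\<close>

lemma root_vector_nilpotent:
  assumes e: "e \<in> root_space \<aa> \<alpha>" and \<alpha>: "\<alpha> \<in> cartan_forms \<aa>" "\<alpha> \<noteq> (\<lambda>_. 0)"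
  shows "\<exists>n. \<forall>x. (lie e ^^ n) x = 0"
proof -
  let ?s = "\<lambda>b n X. wt b X + of_nat n * \<alpha> X"
  have "inj (?s b)" for b
    using \<alpha>(2) by (auto simp: inj_def fun_eq_iff)
  then have "finite (\<Union>b\<in>B. ?s b -` (wt ` B))"
    using finite_B by (intro finite_UN_I finite_vimageI) auto
  then obtain n where n: "n \<notin> (\<Union>b\<in>B. ?s b -` (wt ` B))"
    using ex_new_if_finite[OF infinite_UNIV_nat] by blast
  have b0: "(lie e ^^ n) b = 0" if b: "b \<in> B" for b
  proof (rule ccontr)
    assume "(lie e ^^ n) b \<noteq> 0"
    then obtain b' where "b' \<in> B" "wt b' = ?s b n"
      using root_space_nonzero_wt[OF lie_funpow_root_space[OF e basis_in_root_space[OF b]], of n]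
        cartan_form_add cartan_form_scale \<alpha>(1) wt_cartan_form[OF b] by metis
    then have "?s b n \<in> wt ` B" by (metis imageI)
    then show False using n b by auto
  qed
  have lin: "(lie e ^^ n) (\<Sum>b\<in>I. k b *\<^sub>C b) = (\<Sum>b\<in>I. k b *\<^sub>C (lie e ^^ n) b)" for I k n
    by (induction n) (simp_all add: lie_sum_right lie_cscale_right)
  have "(lie e ^^ n) x = 0" for x
    by (subst basis_expansion) (simp add: lin b0)
  then show ?thesis by blast
qed

definition weight_part :: "('g \<Rightarrow> complex) \<Rightarrow> 'g \<Rightarrow> 'g" where
  "weight_part \<nu> x = (\<Sum>b | b \<in> B \<and> wt b = \<nu>. coord x b *\<^sub>C b)"

lemma weight_part_in: "weight_part \<nu> x \<in> root_space \<aa> \<nu>"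
  unfolding weight_part_def
  by (intro cvec.subspace_sum subspace_root_space cvec.subspace_scale)
     (auto intro: basis_in_root_space)

lemma weight_part_sum: "(\<Sum>\<nu>\<in>wt ` B. weight_part \<nu> x) = x"
proof -
  have "x = (\<Sum>b\<in>B. coord x b *\<^sub>C b)" by (rule basis_expansion)
  also have "\<dots> = (\<Sum>\<nu>\<in>wt ` B. weight_part \<nu> x)"
    unfolding weight_part_def by (rule sum.image_gen[OF finite_B])
  finally show ?thesis by simp
qed

lemma cartan_part_eq_0:
  assumes "x \<in> root_space \<aa> \<nu>" "\<nu> \<in> cartan_forms \<aa>" "\<nu> \<noteq> (\<lambda>_. 0)"
  shows "cartan_part x = 0"
proof -
  have "coord x b = 0" if "b \<in> B \<inter> \<aa>" for b
    using that root_space_wt[OF assms(1,2), of b] wt_zero_iff[of b] assms(3) by auto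
  then show ?thesis by (simp add: cartan_part_def)
qed

text \<open>An ideal is stable under \<open>\<aa>\<close>, hence it is the sum of its weight spaces.\<close>

lemma weight_part_in_ideal:
  assumes I: "lie_ideal I" "x \<in> I"
  shows "weight_part \<nu> x \<in> I"
proof (cases "\<nu> \<in> wt ` B")
  case True
  show ?thesis
  proof (rule weight_components_in_invariant_subspace[where I = "wt ` B" and S = \<aa>
        and w = "\<lambda>\<nu>. \<nu>" and x = "\<lambda>\<nu>. weight_part \<nu> x"])
    show "\<exists>H\<in>\<aa>. \<mu> H \<noteq> \<nu> H" if "\<mu> \<in> wt ` B" "\<nu> \<in> wt ` B" "\<mu> \<noteq> \<nu>" for \<mu> \<nu>
      using that cartan_form_ext wt_cartan_form by (metis imageE)
    show "lie H (weight_part \<nu> x) = \<nu> H *\<^sub>C weight_part \<nu> x" if "H \<in> \<aa>" for H \<nu>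
      using weight_part_in[of \<nu> x] that by (simp add: root_space_def)
  qed (use I finite_B True weight_part_sum in \<open>auto simp: lie_ideal_def\<close>)
next
  case False
  then have "{b. b \<in> B \<and> wt b = \<nu>} = {}" by auto
  then have "weight_part \<nu> x = 0" by (simp only: weight_part_def sum.empty)
  then show ?thesis using I(1) by (simp add: lie_ideal_def cvec.subspace_0)
qed

section \<open>The Killing form\<close>

sublocale fd: finite_dimensional_vector_space "cscale :: complex \<Rightarrow> 'g \<Rightarrow> 'g" B
  by unfold_locales (rule finite_B independent_B span_B)+

lemma coord_linear_endo:
  assumes "linear_endo A"
  shows "coord (A y) b = (\<Sum>c\<in>B. coord y c * coord (A c) b)"
proof -
  interpret A: Vector_Spaces.linear "(*\<^sub>C)" "(*\<^sub>C)" A by (rule assms)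
  show ?thesis
    by (subst basis_expansion[of y]) (simp add: A.sum A.scale coord_sum)
qed

lemma trace_commute:
  assumes "linear_endo A" "linear_endo A'"
  shows "(\<Sum>b\<in>B. coord (A (A' b)) b) = (\<Sum>b\<in>B. coord (A' (A b)) b)"
proof -
  have "(\<Sum>b\<in>B. coord (A (A' b)) b) = (\<Sum>b\<in>B. \<Sum>c\<in>B. coord (A' b) c * coord (A c) b)"
    by (rule sum.cong[OF refl coord_linear_endo[OF assms(1)]])
  also have "\<dots> = (\<Sum>c\<in>B. \<Sum>b\<in>B. coord (A c) b * coord (A' b) c)"
    by (subst sum.swap) (simp add: mult.commute)
  also have "\<dots> = (\<Sum>c\<in>B. coord (A' (A c)) c)"
    by (rule sum.cong[OF refl coord_linear_endo[OF assms(2), symmetric]])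
  finally show ?thesis .
qed

lemma linear_endo_lie_lie: "linear_endo (\<lambda>Z. lie X (lie Y (Z::'g)))"
  by (rule linear_endoI) (simp_all add: lie_add_right lie_cscale_right)

lemma killing_coord: "killing X Y = (\<Sum>b\<in>B. coord (lie X (lie Y b)) b)"
  unfolding killing_def by (rule endo_trace_coord[OF linear_endo_lie_lie])

lemma killing_sym: "killing X Y = killing Y (X::'g)"
  unfolding killing_coord by (rule trace_commute) (rule linear_endo_lie)+

lemma killing_add_left: "killing (X + Y) Z = killing X Z + killing Y (Z::'g)"
  by (simp add: killing_coord lie_add_left sum.distrib)

lemma killing_scale_left: "killing (c *\<^sub>C X) Z = c * killing X (Z::'g)"
  by (simp add: killing_coord lie_cscale_left sum_distrib_left)

lemma killing_add_right: "killing Z (X + Y) = killing Z X + killing Z (Y::'g)"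
  using killing_add_left killing_sym by metis

lemma killing_scale_right: "killing Z (c *\<^sub>C X) = c * killing Z (X::'g)"
  using killing_scale_left killing_sym by metis

lemma linear_form_killing: "linear_form (killing (X::'g))"
  by (rule linear_formI) (simp_all add: killing_add_right killing_scale_right)

lemma killing_diff_left: "killing (X - Y) Z = killing X Z - killing Y (Z::'g)"
  using killing_add_left[of "X - Y" Y Z] by simp

lemma killing_invariant: "killing (lie X Y) Z = killing X (lie Y (Z::'g))"
proof -
  have 1: "killing (lie X Y) Z =
      (\<Sum>b\<in>B. coord (lie X (lie Y (lie Z b))) b) - (\<Sum>b\<in>B. coord (lie Y (lie X (lie Z b))) b)"
    unfolding killing_coord sum_subtractf[symmetric]
    by (simp add: lie_derivation[of X Y] flip: coord_diff)
  have 2: "killing X (lie Y Z) =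
      (\<Sum>b\<in>B. coord (lie X (lie Y (lie Z b))) b) - (\<Sum>b\<in>B. coord (lie X (lie Z (lie Y b))) b)"
    unfolding killing_coord sum_subtractf[symmetric]
    by (simp add: lie_derivation[of Y Z] lie_add_right flip: coord_diff)
  show ?thesis
    unfolding 1 2 using trace_commute[OF linear_endo_lie linear_endo_lie_lie, of Y X Z] by simp
qed

lemma killing_root_spaces:
  assumes "x \<in> root_space \<aa> \<mu>" "y \<in> root_space \<aa> \<nu>" "H \<in> \<aa>" "\<mu> H + \<nu> H \<noteq> 0"
  shows "killing x y = 0"
proof -
  have e: "lie H x = \<mu> H *\<^sub>C x" "lie H y = \<nu> H *\<^sub>C y"
    using assms by (simp_all add: root_space_def)
  have "killing (lie H x) y = - killing (lie x H) y"
    using killing_scale_left[of "-1" "lie x H" y] lie_anti[of H x] by simp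
  also have "killing (lie x H) y = killing x (lie H y)" by (rule killing_invariant)
  finally have "\<mu> H * killing x y = - (\<nu> H * killing x y)"
    unfolding e killing_scale_left killing_scale_right .
  then have "(\<mu> H + \<nu> H) * killing x y = 0" by (simp add: distrib_right)
  then show ?thesis using assms(4) by simp
qed

lemma killing_cartan:
  assumes "H \<in> \<aa>" "H' \<in> \<aa>"
  shows "killing H H' = (\<Sum>b\<in>B. wt b H * wt b H')"
  unfolding killing_coord
  by (rule sum.cong) (use assms in \<open>auto simp: lie_wt lie_cscale_right coord_basis\<close>)

subsection \<open>Strings of weights\<close>

text \<open>Climb from \<open>v\<close> with \<open>e\<close> until the ladder stops, then descend with \<open>f\<close>.\<close>

lemma weight_string:
  assumes \<alpha>: "\<alpha> \<in> cartan_forms \<aa>" "\<alpha> \<noteq> (\<lambda>_. 0)"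
    and e: "e \<in> root_space \<aa> \<alpha>" and f: "f \<in> root_space \<aa> (\<lambda>X. - \<alpha> X)"
    and v: "v \<in> root_space \<aa> \<beta>" "v \<noteq> 0"
  obtains m k :: nat where "(lie e ^^ m) v \<noteq> 0" "(lie e ^^ Suc m) v = 0"
    "\<beta> (lie e f) + of_nat m * \<alpha> (lie e f) = of_nat k * \<alpha> (lie e f) / 2"
    "\<forall>j\<le>k. (lie f ^^ j) ((lie e ^^ m) v) \<noteq> 0"
proof -
  define n where "n = (LEAST n. (lie e ^^ n) v = 0)"
  have "\<exists>n. (lie e ^^ n) v = 0" using root_vector_nilpotent[OF e \<alpha>] by blast
  then have n: "(lie e ^^ n) v = 0" "\<And>j. j < n \<Longrightarrow> (lie e ^^ j) v \<noteq> 0"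
    unfolding n_def by (auto intro: LeastI_ex dest: not_less_Least)
  have "n \<noteq> 0" using n(1) v(2) by (metis funpow_0)
  then obtain m where m: "n = Suc m" by (cases n) auto
  let ?w = "(lie e ^^ m) v" and ?H = "lie e f"
  have H: "?H \<in> \<aa>" using lie_root_space_opposite[OF e f] .
  have f0: "(\<lambda>X. - \<alpha> X) \<noteq> (\<lambda>_. 0)" using \<alpha>(2) by (auto simp: fun_eq_iff)
  have nil: "\<exists>n. \<forall>x. (lie f ^^ n) x = 0"
    using root_vector_nilpotent[OF f cartan_form_minus[OF \<alpha>(1)] f0] .
  have 1: "lie e ?w = 0" using n(1) m by simp
  have 2: "lie ?H f = - \<alpha> ?H *\<^sub>C f" using f H by (simp add: root_space_def)
  have 3: "lie ?H ?w = (\<beta> ?H + of_nat m * \<alpha> ?H) *\<^sub>C ?w"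
    using lie_funpow_root_space[OF e v(1), of m] H by (simp add: root_space_def)
  have 4: "?w \<noteq> 0" using n(2) m by simp
  obtain p where p: "(lie f ^^ p) ?w = 0" using nil by blast
  obtain k :: nat where k: "\<beta> ?H + of_nat m * \<alpha> ?H = of_nat k * \<alpha> ?H / 2"
    "\<forall>j\<le>k. (lie f ^^ j) ?w \<noteq> 0"
    using ladder[OF 1 2 3 4 p] by blast
  then show ?thesis using that[of m k] 4 n(1) m by simp
qed

lemma abelian_ideal_trivial:
  assumes "lie_ideal I" "\<And>X Y. X \<in> I \<Longrightarrow> Y \<in> I \<Longrightarrow> lie X Y = (0::'g)"
  shows "I = {0}"
proof -
  have "{lie X Y | X Y. X \<in> I \<and> Y \<in> I} \<subseteq> {0}" using assms(2) by auto
  then have "cvec.span {lie X Y | X Y. X \<in> I \<and> Y \<in> I} \<subseteq> {0}"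
    by (rule cvec.span_minimal) simp
  then have "derived_series I (Suc 0) = {0}" using cvec.span_zero by auto
  then have "solvable I" unfolding solvable_def by blast
  then show ?thesis using semisimple assms(1) by (simp add: semisimple_lie_algebra_def)
qed

text \<open>The line through such an element is an abelian ideal.\<close>

lemma cartan_eq_0:
  assumes H: "H \<in> \<aa>" "\<And>b. b \<in> B \<Longrightarrow> wt b H = 0"
  shows "H = 0"
proof -
  have "lie H X = 0" for X
    by (subst basis_expansion[of X]) (simp add: lie_sum_right lie_cscale_right lie_wt H)
  then have "lie X H = 0" for X using lie_anti[of X H] by simp
  then have "lie X Y \<in> {0}" if "Y \<in> cvec.span {H}" for X Y
    using that by (intro act_on_span_in_subspace[OF _ cvec.subspace_single_0, of Y "{H}"]) auto
  then have "cvec.span {H} = {0}"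
    by (intro abelian_ideal_trivial) (auto simp: lie_ideal_def cvec.span_zero)
  then show ?thesis using cvec.span_base[of H "{H}"] by auto
qed

text \<open>By \<open>weight_string\<close> all weights take on \<open>lie e f\<close> values that are real multiples of
  \<open>\<alpha> (lie e f)\<close>, so the trace defining \<open>killing (lie e f) (lie e f)\<close> is a sum of real squares
  up to one common factor. This includes the case that \<open>\<alpha> (lie e f)\<close> vanishes.\<close>

lemma killing_isotropic_bracket:
  assumes \<alpha>: "\<alpha> \<in> cartan_forms \<aa>" "\<alpha> \<noteq> (\<lambda>_. 0)"
    and e: "e \<in> root_space \<aa> \<alpha>" and f: "f \<in> root_space \<aa> (\<lambda>X. - \<alpha> X)"
    and 0: "killing (lie e f) (lie e f) = 0"
  shows "lie e f = 0"
proof -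
  let ?H = "lie e f"
  have H: "?H \<in> \<aa>" using lie_root_space_opposite[OF e f] .
  have "\<exists>q::real. wt b ?H = of_real q * \<alpha> ?H" if b: "b \<in> B" for b
  proof -
    obtain m k :: nat where "wt b ?H + of_nat m * \<alpha> ?H = of_nat k * \<alpha> ?H / 2"
      by (rule weight_string[OF \<alpha> e f basis_in_root_space[OF b] basis_nonzero[OF b]])
    then have "wt b ?H = of_real (of_nat k / 2 - of_nat m) * \<alpha> ?H"
      by (simp add: algebra_simps)
    then show ?thesis ..
  qed
  then obtain q :: "'g \<Rightarrow> real" where q: "\<And>b. b \<in> B \<Longrightarrow> wt b ?H = of_real (q b) * \<alpha> ?H"
    by metis
  have "killing ?H ?H = of_real (\<Sum>b\<in>B. (q b)\<^sup>2) * (\<alpha> ?H)\<^sup>2"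
    unfolding killing_cartan[OF H H] of_real_sum sum_distrib_right
    by (rule sum.cong) (simp_all add: q power2_eq_square)
  then have "(\<Sum>b\<in>B. (q b)\<^sup>2) = 0 \<or> \<alpha> ?H = 0" using 0 by (simp del: of_real_sum)
  then have "wt b ?H = 0" if "b \<in> B" for b
    using q[OF that] that finite_B by (auto simp: sum_nonneg_eq_0_iff)
  then show ?thesis using cartan_eq_0[OF H] by blast
qed

subsection \<open>Nondegeneracy\<close>

text \<open>A minimal nonzero ideal \<open>I\<close> in the radical of the Killing form is perfect. Its part in \<open>\<aa>\<close> is spanned
  by brackets of opposite root vectors, which are isotropic and hence zero. So \<open>I\<close> is spanned by
  ad-nilpotent weight vectors, and such a space cannot be perfect.\<close>

theorem killing_nondegenerate:
  assumes "\<And>Y. killing X Y = 0"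
  shows "X = (0::'g)"
proof (rule ccontr)
  assume "X \<noteq> 0"
  define S where "S = {X::'g. \<forall>Y. killing X Y = 0}"
  have S: "lie_ideal S"
    unfolding lie_ideal_def
  proof (intro conjI allI ballI)
    show "cvec.subspace S"
      using killing_scale_left[of 0 0]
      by (auto simp: S_def cvec.subspace_def killing_add_left killing_scale_left)
    show "lie X Z \<in> S" if "Z \<in> S" for X Z
    proof -
      have "killing (lie Z X) Y = 0" for Y using that by (simp add: killing_invariant S_def)
      then show ?thesis
        using killing_scale_left[of "-1" "lie Z X"] lie_anti[of X Z] by (simp add: S_def)
    qed
  qed
  define P where "P I \<longleftrightarrow> lie_ideal I \<and> I \<subseteq> S \<and> I \<noteq> {0}" for I :: "'g set"
  have "P S" using S assms \<open>X \<noteq> 0\<close> by (auto simp: P_def S_def)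
  then obtain I where I: "P I" and min: "\<And>J. P J \<Longrightarrow> cvec.dim I \<le> cvec.dim J"
    using ex_has_least_nat[of P S cvec.dim] by auto
  have ideal: "lie_ideal I" "I \<subseteq> S" "I \<noteq> {0}" "cvec.subspace I"
    using I by (auto simp: P_def lie_ideal_def)
  have in_I: "lie X Y \<in> I" if "Y \<in> I" for X Y using that ideal(1) by (simp add: lie_ideal_def)
  let ?D = "{lie X Y | X Y. X \<in> I \<and> Y \<in> I}"
  have D_sub: "cvec.span ?D \<subseteq> I"
    by (rule cvec.span_minimal[OF _ ideal(4)]) (auto intro: in_I)
  have D_ideal: "lie_ideal (cvec.span ?D)"
    unfolding lie_ideal_def
  proof (intro conjI allI ballI)
    fix X Y assume "Y \<in> cvec.span ?D"
    then show "lie X Y \<in> cvec.span ?D"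
    proof (rule act_on_span_in_subspace)
      fix u assume "u \<in> ?D"
      then obtain y z where u: "u = lie y z" "y \<in> I" "z \<in> I" by blast
      show "lie X u \<in> cvec.span ?D"
        unfolding u(1) lie_derivation[of X y z]
        by (intro cvec.span_add cvec.span_base) (use u in_I in blast)+
    qed simp
  qed simp
  have perfect: "cvec.span ?D = I"
  proof (cases "cvec.span ?D = {0}")
    case True
    then have "lie X Y = 0" if "X \<in> I" "Y \<in> I" for X Y
      using cvec.span_base[of "lie X Y" ?D] that by blast
    then show ?thesis using abelian_ideal_trivial[OF ideal(1)] ideal(3) by blast
  next
    case False
    then have "P (cvec.span ?D)" using D_ideal D_sub ideal(2) by (auto simp: P_def)
    then show ?thesis
      using min D_sub fd.subspace_dim_equal[OF cvec.subspace_span ideal(4)] by blast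
  qed
  define W where "W = {x \<in> I. \<exists>\<nu>\<in>cartan_forms \<aa>. x \<in> root_space \<aa> \<nu>}"
  have IW: "I \<subseteq> cvec.span W"
  proof
    fix x assume x: "x \<in> I"
    have "weight_part \<nu> x \<in> W" if "\<nu> \<in> wt ` B" for \<nu>
    proof -
      have "\<nu> \<in> cartan_forms \<aa>" using that wt_cartan_form by blast
      then show ?thesis
        unfolding W_def using weight_part_in_ideal[OF ideal(1) x] weight_part_in by blast
    qed
    then have "(\<Sum>\<nu>\<in>wt ` B. weight_part \<nu> x) \<in> cvec.span W"
      by (intro cvec.span_sum cvec.span_base)
    then show "x \<in> cvec.span W" by (simp add: weight_part_sum)
  qed
  have WW: "cartan_part (lie x y) = 0" if xy: "x \<in> W" "y \<in> W" for x y
  proof -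
    obtain \<mu> \<nu> where x: "x \<in> I" "\<mu> \<in> cartan_forms \<aa>" "x \<in> root_space \<aa> \<mu>"
      and y: "y \<in> I" "\<nu> \<in> cartan_forms \<aa>" "y \<in> root_space \<aa> \<nu>"
      using xy by (auto simp: W_def)
    show ?thesis
    proof (cases "(\<lambda>X. \<mu> X + \<nu> X) = (\<lambda>_. 0)")
      case False
      then show ?thesis
        using cartan_part_eq_0[OF lie_root_space[OF x(3) y(3)] cartan_form_add[OF x(2) y(2)]]
        by blast
    next
      case True
      then have \<nu>: "\<nu> = (\<lambda>X. - \<mu> X)" by (auto simp: fun_eq_iff add_eq_0_iff)
      have "lie x y = 0"
      proof (cases "\<mu> = (\<lambda>_. 0)")
        case True
        then have "x \<in> \<aa>" "y \<in> \<aa>" using x(3) y(3) \<nu> by (auto simp: root_space_zero)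
        then show ?thesis by (rule cartan_commute)
      next
        case False
        have "lie x y \<in> S" using in_I[OF y(1)] ideal(2) by blast
        then show ?thesis
          using killing_isotropic_bracket[OF x(2) False x(3)] y(3) \<nu> by (simp add: S_def)
      qed
      then show ?thesis using cartan_part_scale[of 0 0] by simp
    qed
  qed
  have sub0: "cvec.subspace {x. cartan_part x = 0}"
    using cartan_part_scale[of 0 0]
    by (auto simp: cvec.subspace_def cartan_part_add cartan_part_scale)
  have no_cartan: "cartan_part x = 0" if "x \<in> I" for x
  proof -
    have half: "lie y z \<in> {x. cartan_part x = 0}" if "y \<in> W" "z \<in> I" for y z
      using subsetD[OF IW that(2)] sub0
      by (rule act_on_span_in_subspace) (simp add: WW that(1))
    have "lie y z \<in> {x. cartan_part x = 0}" if "y \<in> I" "z \<in> I" for y z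
      using subsetD[OF IW that(1)] sub0
      by (rule span_act_in_subspace) (rule half[OF _ that(2)])
    then have "cvec.span ?D \<subseteq> {x. cartan_part x = 0}"
      by (intro cvec.span_minimal sub0) blast
    then show ?thesis using perfect that by blast
  qed
  have "lie_closed W"
    unfolding lie_closed_def W_def using in_I lie_root_space cartan_form_add by blast
  moreover have "\<exists>n. \<forall>x. (lie w ^^ n) x = 0" if w: "w \<in> W" for w
  proof -
    obtain \<nu> where \<nu>: "w \<in> I" "\<nu> \<in> cartan_forms \<aa>" "w \<in> root_space \<aa> \<nu>"
      using w by (auto simp: W_def)
    show ?thesis
    proof (cases "\<nu> = (\<lambda>_. 0)")
      case True
      then have "w = 0"
        using \<nu>(3) no_cartan[OF \<nu>(1)] cartan_part_id by (auto simp: root_space_zero)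
      then show ?thesis by (intro exI[of _ 1]) simp
    next
      case False
      then show ?thesis using root_vector_nilpotent \<nu> by blast
    qed
  qed
  ultimately have "shrinking W" by (rule weakly_closed_nilpotent_shrinking)
  moreover have stable: "lie_stable W {0}" "lie_stable W I" "{0} \<subset> I"
    using ideal in_I cvec.subspace_0[OF ideal(4)] by (auto simp: lie_stable_def)
  ultimately have "action_span W {0} I \<noteq> I" unfolding shrinking_def by blast
  moreover have "cvec.span ?D \<subseteq> action_span W {0} I"
  proof (rule cvec.span_minimal[OF _ subspace_action_span], rule subsetI)
    fix u assume "u \<in> ?D"
    then obtain y z where u: "u = lie y z" "y \<in> I" "z \<in> I" by blast
    have "y \<in> cvec.span W" using u(2) IW by blast
    then show "u \<in> action_span W {0} I"
      unfolding u(1) using subspace_action_span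
      by (rule span_act_in_subspace) (rule action_span_base(2)[OF _ u(3)])
  qed
  moreover have "action_span W {0} I \<subseteq> I"
    using action_span_subset[OF stable(2), of "{0}"] stable(3) by blast
  ultimately show False using perfect by simp
qed

subsection \<open>Dual vectors\<close>

lemma killing_cartan_basis:
  assumes "b \<in> B - \<aa>" "H \<in> \<aa>"
  shows "killing b H = 0"
proof -
  obtain H' where "H' \<in> \<aa>" "wt b H' \<noteq> 0"
    using assms basis_in_cartan_iff[of b] by (auto simp: wt_def cartan_part_id)
  then show ?thesis
    using killing_root_spaces[of b "wt b" H "\<lambda>_. 0" H'] assms basis_in_root_space[of b]
    by (simp add: root_space_zero)
qed

lemma killing_expand_left: "killing X Y = (\<Sum>b\<in>B. coord X b * killing b (Y::'g))"
proof -
  have "killing X Y = killing Y (\<Sum>b\<in>B. coord X b *\<^sub>C b)"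
    by (subst killing_sym, subst basis_expansion[of X]) (rule refl)
  also have "\<dots> = (\<Sum>b\<in>B. coord X b * killing Y b)"
    by (simp add: linear_form_sum[OF linear_form_killing] killing_scale_right)
  finally show ?thesis by (simp only: killing_sym[of Y])
qed

lemma killing_cartan_part:
  assumes "H \<in> \<aa>"
  shows "killing (cartan_part X) H = killing X H"
proof -
  have "killing X H = (\<Sum>b\<in>B \<inter> \<aa>. coord X b * killing b H)"
    by (subst killing_expand_left, rule sum.mono_neutral_right)
       (use finite_B killing_cartan_basis assms in auto)
  also have "\<dots> = killing H (cartan_part X)"
    by (simp add: cartan_part_def linear_form_sum[OF linear_form_killing] killing_scale_right
        killing_sym[of H])
  finally show ?thesis by (simp add: killing_sym)
qed

lemma killing_nondegenerate_cartan:
  assumes T: "T \<in> \<aa>" and 0: "\<And>H. H \<in> \<aa> \<Longrightarrow> killing T H = 0"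
  shows "T = 0"
proof (rule killing_nondegenerate)
  fix Y
  have "killing T Y = killing (cartan_part Y) T"
    using killing_cartan_part[OF T] killing_sym by metis
  also have "\<dots> = 0" using 0[OF cartan_part_in] killing_sym by metis
  finally show "killing T Y = 0" .
qed

text \<open>By nondegeneracy every linear form on the whole algebra is represented by some \<open>Y\<close>, and the
  components of \<open>Y\<close> outside \<open>\<aa>\<close> are orthogonal to \<open>\<aa>\<close>.\<close>

lemma dual_vector:
  assumes \<nu>: "linear_form \<nu>"
  shows "dual_vector \<aa> \<nu> \<in> \<aa> \<and> (\<forall>H\<in>\<aa>. killing (dual_vector \<aa> \<nu>) H = \<nu> H)"
proof -
  define \<Phi> where "\<Phi> X = (\<Sum>b\<in>B. killing X b *\<^sub>C b)" for X :: 'g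
  have lin: "linear_endo \<Phi>"
    by (rule linear_endoI)
       (simp_all add: \<Phi>_def killing_add_left killing_scale_left cvec.scale_left_distrib
         sum.distrib cvec.scale_sum_right)
  have coord_\<Phi>: "coord (\<Phi> X) b = killing X b" if "b \<in> B" for X b
    unfolding \<Phi>_def using coord_combination[OF subset_refl that] that by simp
  have "inj \<Phi>"
  proof (rule injI)
    fix X Y assume eq: "\<Phi> X = \<Phi> Y"
    have "killing b (X - Y) = 0" if "b \<in> B" for b
      using coord_\<Phi>[OF that, of X] coord_\<Phi>[OF that, of Y] eq
      by (simp add: killing_sym[of b] killing_diff_left)
    then have "killing (X - Y) Z = 0" for Z
      using killing_expand_left[of Z "X - Y"] killing_sym[of "X - Y" Z] by simp
    then show "X = Y" using killing_nondegenerate[of "X - Y"] by simp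
  qed
  then have "surj \<Phi>" by (rule fd.linear_inj_imp_surj[OF lin])
  then obtain Y where Y: "\<Phi> Y = (\<Sum>b\<in>B. \<nu> b *\<^sub>C b)" by (metis surjD)
  have Yb: "killing Y b = \<nu> b" if "b \<in> B" for b
    using coord_\<Phi>[OF that, of Y] coord_combination[OF subset_refl that, of \<nu>] that Y by simp
  have YZ: "killing Y Z = \<nu> Z" for Z
  proof -
    have "killing Y Z = (\<Sum>b\<in>B. coord Z b * \<nu> b)"
      by (subst basis_expansion[of Z])
         (simp add: linear_form_sum[OF linear_form_killing] killing_scale_right Yb)
    also have "\<dots> = \<nu> Z"
      by (subst (2) basis_expansion[of Z])
         (simp add: linear_form_sum[OF \<nu>] linear_form_scale[OF \<nu>])
    finally show ?thesis .
  qed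
  have "\<exists>!T. T \<in> \<aa> \<and> (\<forall>H\<in>\<aa>. killing T H = \<nu> H)"
  proof (rule ex1I[of _ "cartan_part Y"])
    show "cartan_part Y \<in> \<aa> \<and> (\<forall>H\<in>\<aa>. killing (cartan_part Y) H = \<nu> H)"
      by (simp add: cartan_part_in killing_cartan_part YZ)
    fix T assume T: "T \<in> \<aa> \<and> (\<forall>H\<in>\<aa>. killing T H = \<nu> H)"
    have "T - cartan_part Y = 0"
      by (rule killing_nondegenerate_cartan)
         (use T in \<open>auto simp: killing_diff_left killing_cartan_part YZ
           intro: cvec.subspace_diff[OF subspace_cartan] cartan_part_in\<close>)
    then show "T = cartan_part Y" by simp
  qed
  then show ?thesis unfolding dual_vector_def by (rule theI')
qed

lemma dual_vector_in: "linear_form \<nu> \<Longrightarrow> dual_vector \<aa> \<nu> \<in> \<aa>"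
  and killing_dual_vector: "linear_form \<nu> \<Longrightarrow> H \<in> \<aa> \<Longrightarrow> killing (dual_vector \<aa> \<nu>) H = \<nu> H"
  using dual_vector by blast+

lemma form_inner_eq:
  "linear_form \<nu> \<Longrightarrow> linear_form \<mu> \<Longrightarrow> form_inner \<aa> \<nu> \<mu> = \<nu> (dual_vector \<aa> \<mu>)"
  by (simp add: form_inner_def killing_dual_vector dual_vector_in)

section \<open>Roots, coroots and reflections\<close>

lemma root_form:
  assumes "\<alpha> \<in> lie_roots \<aa>"
  shows root_cartan_form: "\<alpha> \<in> cartan_forms \<aa>" and root_nonzero: "\<alpha> \<noteq> (\<lambda>_. 0)"
    and root_linear: "linear_form \<alpha>"
  using assms by (auto simp: lie_roots_def cartan_forms_def)

lemma root_vector: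
  assumes "\<alpha> \<in> lie_roots \<aa>"
  obtains e where "e \<in> root_space \<aa> \<alpha>" "e \<noteq> 0"
proof -
  have "root_space \<aa> \<alpha> \<noteq> {0}" using assms by (simp add: lie_roots_def)
  then show ?thesis using that cvec.subspace_0[OF subspace_root_space[of \<alpha>]] by auto
qed

lemma rootI:
  assumes "\<nu> \<in> cartan_forms \<aa>" "\<nu> \<noteq> (\<lambda>_. 0)" "x \<in> root_space \<aa> \<nu>" "x \<noteq> 0"
  shows "\<nu> \<in> lie_roots \<aa>"
proof -
  have "\<exists>H\<in>\<aa>. \<nu> H \<noteq> 0"
    using assms(2) cartan_form_ext[OF assms(1) cartan_form_0] by blast
  then show ?thesis using assms by (auto simp: lie_roots_def)
qed

lemma roots_eq_weights: "lie_roots \<aa> = wt ` (B - \<aa>)"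
proof (intro equalityI subsetI)
  fix \<alpha> assume \<alpha>: "\<alpha> \<in> lie_roots \<aa>"
  obtain e where e: "e \<in> root_space \<aa> \<alpha>" "e \<noteq> 0" by (rule root_vector[OF \<alpha>])
  obtain b where "b \<in> B" "wt b = \<alpha>"
    by (rule root_space_nonzero_wt[OF e(1) root_cartan_form[OF \<alpha>] e(2)])
  then show "\<alpha> \<in> wt ` (B - \<aa>)" using wt_zero_iff[of b] root_nonzero[OF \<alpha>] by auto
next
  fix \<alpha> assume "\<alpha> \<in> wt ` (B - \<aa>)"
  then obtain b where "b \<in> B" "b \<notin> \<aa>" "\<alpha> = wt b" by auto
  then show "\<alpha> \<in> lie_roots \<aa>"
    using rootI[OF wt_cartan_form _ basis_in_root_space basis_nonzero] wt_zero_iff by auto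
qed

lemma finite_roots: "finite (lie_roots \<aa>)"
  unfolding roots_eq_weights using finite_B by simp

lemma cartan_eq_0_of_roots:
  assumes "H \<in> \<aa>" "\<And>\<alpha>. \<alpha> \<in> lie_roots \<aa> \<Longrightarrow> \<alpha> H = 0"
  shows "H = 0"
proof (rule cartan_eq_0[OF assms(1)])
  show "wt b H = 0" if "b \<in> B" for b
    using that assms(2) wt_zero_iff[OF that] roots_eq_weights by (cases "b \<in> \<aa>") auto
qed

lemma lie_opposite_root_vectors:
  assumes \<alpha>: "\<alpha> \<in> cartan_forms \<aa>"
    and e: "e \<in> root_space \<aa> \<alpha>" and f: "f \<in> root_space \<aa> (\<lambda>X. - \<alpha> X)"
  shows "lie e f = killing e f *\<^sub>C dual_vector \<aa> \<alpha>"
proof -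
  let ?T = "dual_vector \<aa> \<alpha>"
  have lin: "linear_form \<alpha>" using \<alpha> by (rule cartan_form_linear)
  have "lie e f - killing e f *\<^sub>C ?T = 0"
  proof (rule killing_nondegenerate_cartan)
    show "lie e f - killing e f *\<^sub>C ?T \<in> \<aa>"
      by (intro cvec.subspace_diff[OF subspace_cartan] cvec.subspace_scale[OF subspace_cartan]
          lie_root_space_opposite[OF e f] dual_vector_in[OF lin])
    fix H assume H: "H \<in> \<aa>"
    have "lie f H = \<alpha> H *\<^sub>C f"
      using f H lie_anti[of f H] by (simp add: root_space_def)
    then have "killing (lie e f) H = \<alpha> H * killing e f"
      by (simp add: killing_invariant killing_scale_right)
    then show "killing (lie e f - killing e f *\<^sub>C ?T) H = 0"
      by (simp add: killing_diff_left killing_scale_left killing_dual_vector[OF lin H])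
  qed
  then show ?thesis by simp
qed

lemma opposite_root_vector:
  assumes \<alpha>: "\<alpha> \<in> cartan_forms \<aa>" and e: "e \<in> root_space \<aa> \<alpha>" "e \<noteq> 0"
  obtains f where "f \<in> root_space \<aa> (\<lambda>X. - \<alpha> X)" "killing e f \<noteq> 0"
proof -
  obtain Y where Y: "killing e Y \<noteq> 0" using killing_nondegenerate e(2) by blast
  have "killing e Y = (\<Sum>b\<in>B. coord Y b * killing b e)"
    by (subst killing_sym) (rule killing_expand_left)
  then obtain b where b: "b \<in> B" "killing b e \<noteq> 0"
    using Y by (metis (no_types, lifting) mult_zero_right sum.neutral)
  have be: "killing e b \<noteq> 0" using b(2) by (simp add: killing_sym)
  have "wt b = (\<lambda>X. - \<alpha> X)"
  proof (rule cartan_form_ext[OF wt_cartan_form[OF b(1)] cartan_form_minus[OF \<alpha>]])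
    fix H assume "H \<in> \<aa>"
    then have "\<alpha> H + wt b H = 0"
      using killing_root_spaces[OF e(1) basis_in_root_space[OF b(1)]] be by blast
    then show "wt b H = - \<alpha> H" by (simp add: eq_neg_iff_add_eq_0 add.commute)
  qed
  then show ?thesis using that[of b] be basis_in_root_space[OF b(1)] by simp
qed

lemma root_minus:
  assumes \<alpha>: "\<alpha> \<in> lie_roots \<aa>"
  shows "(\<lambda>X. - \<alpha> X) \<in> lie_roots \<aa>"
proof -
  obtain e where e: "e \<in> root_space \<aa> \<alpha>" "e \<noteq> 0" by (rule root_vector[OF \<alpha>])
  obtain f where f: "f \<in> root_space \<aa> (\<lambda>X. - \<alpha> X)" "killing e f \<noteq> 0"
    by (rule opposite_root_vector[OF root_cartan_form[OF \<alpha>] e])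
  have "f \<noteq> 0" using f(2) killing_scale_right[of e 0 0] by auto
  then show ?thesis
    using root_nonzero[OF \<alpha>]
    by (intro rootI[OF cartan_form_minus[OF root_cartan_form[OF \<alpha>]] _ f(1)])
       (auto simp: fun_eq_iff)
qed

text \<open>Otherwise a nonzero bracket of opposite root vectors would be isotropic.\<close>

lemma root_dual_vector_nonzero:
  assumes \<alpha>: "\<alpha> \<in> lie_roots \<aa>"
  shows "\<alpha> (dual_vector \<aa> \<alpha>) \<noteq> 0"
proof
  let ?T = "dual_vector \<aa> \<alpha>"
  assume 0: "\<alpha> ?T = 0"
  obtain e where e: "e \<in> root_space \<aa> \<alpha>" "e \<noteq> 0" by (rule root_vector[OF \<alpha>])
  obtain f where f: "f \<in> root_space \<aa> (\<lambda>X. - \<alpha> X)" "killing e f \<noteq> 0"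
    by (rule opposite_root_vector[OF root_cartan_form[OF \<alpha>] e])
  have lie: "lie e f = killing e f *\<^sub>C ?T"
    by (rule lie_opposite_root_vectors[OF root_cartan_form[OF \<alpha>] e(1) f(1)])
  have "killing ?T ?T = 0"
    using killing_dual_vector[OF root_linear[OF \<alpha>] dual_vector_in[OF root_linear[OF \<alpha>]]] 0 by simp
  then have "lie e f = 0"
    by (intro killing_isotropic_bracket[OF root_cartan_form[OF \<alpha>] root_nonzero[OF \<alpha>] e(1) f(1)])
       (simp add: lie killing_scale_left killing_scale_right)
  then have "?T = 0" using lie f(2) by simp
  then have "\<alpha> H = 0" if "H \<in> \<aa>" for H
    using killing_dual_vector[OF root_linear[OF \<alpha>] that] killing_scale_left[of 0 0 H] by simp
  then show False
    using cartan_form_ext[OF root_cartan_form[OF \<alpha>] cartan_form_0] root_nonzero[OF \<alpha>] by blast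
qed

definition coroot :: "('g \<Rightarrow> complex) \<Rightarrow> 'g" where
  "coroot \<alpha> = (2 / \<alpha> (dual_vector \<aa> \<alpha>)) *\<^sub>C dual_vector \<aa> \<alpha>"

lemma coroot_in: "\<alpha> \<in> lie_roots \<aa> \<Longrightarrow> coroot \<alpha> \<in> \<aa>"
  unfolding coroot_def
  by (intro cvec.subspace_scale[OF subspace_cartan] dual_vector_in root_linear)

lemma root_coroot: "\<alpha> \<in> lie_roots \<aa> \<Longrightarrow> \<alpha> (coroot \<alpha>) = 2"
  using root_dual_vector_nonzero by (simp add: coroot_def linear_form_scale root_linear)

lemma form_inner_coroot:
  assumes "\<alpha> \<in> lie_roots \<aa>" "linear_form \<nu>"
  shows "2 * (form_inner \<aa> \<nu> \<alpha> / form_inner \<aa> \<alpha> \<alpha>) = \<nu> (coroot \<alpha>)"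
  using assms(2) root_linear[OF assms(1)]
  by (simp add: form_inner_eq coroot_def linear_form_scale)

lemma dual_vector_minus:
  assumes \<nu>: "linear_form \<nu>"
  shows "dual_vector \<aa> (\<lambda>X. - \<nu> X) = - dual_vector \<aa> \<nu>"
proof -
  have \<nu>': "linear_form (\<lambda>X. - \<nu> X)"
    by (rule linear_formI) (simp_all add: linear_form_add[OF \<nu>] linear_form_scale[OF \<nu>])
  have "dual_vector \<aa> (\<lambda>X. - \<nu> X) + dual_vector \<aa> \<nu> = 0"
    by (rule killing_nondegenerate_cartan)
       (simp_all add: cvec.subspace_add[OF subspace_cartan] dual_vector_in \<nu> \<nu>'
         killing_add_left killing_dual_vector)
  then show ?thesis by (simp add: eq_neg_iff_add_eq_0)
qed

lemma coroot_minus: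
  assumes "\<alpha> \<in> lie_roots \<aa>"
  shows "coroot (\<lambda>X. - \<alpha> X) = - coroot \<alpha>"
  using linear_form_scale[OF root_linear[OF assms], of "-1"]
  by (simp add: coroot_def dual_vector_minus[OF root_linear[OF assms]])

lemma sl2_triple:
  assumes \<alpha>: "\<alpha> \<in> lie_roots \<aa>" and e: "e \<in> root_space \<aa> \<alpha>" "e \<noteq> 0"
  obtains f where "f \<in> root_space \<aa> (\<lambda>X. - \<alpha> X)" "lie e f = coroot \<alpha>"
proof -
  obtain f where f: "f \<in> root_space \<aa> (\<lambda>X. - \<alpha> X)" "killing e f \<noteq> 0"
    by (rule opposite_root_vector[OF root_cartan_form[OF \<alpha>] e])
  let ?c = "2 / (killing e f * \<alpha> (dual_vector \<aa> \<alpha>))"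
  have "lie e (?c *\<^sub>C f) = coroot \<alpha>"
    using lie_opposite_root_vectors[OF root_cartan_form[OF \<alpha>] e(1) f(1)] f(2)
    by (simp add: lie_cscale_right coroot_def)
  then show ?thesis using that cvec.subspace_scale[OF subspace_root_space f(1)] by blast
qed

lemma weight_string_coroot:
  assumes \<alpha>: "\<alpha> \<in> lie_roots \<aa>"
    and e: "e \<in> root_space \<aa> \<alpha>" and f: "f \<in> root_space \<aa> (\<lambda>X. - \<alpha> X)"
    and ef: "lie e f = coroot \<alpha>"
    and v: "v \<in> root_space \<aa> \<beta>" "v \<noteq> 0"
  obtains m k :: nat where "(lie e ^^ m) v \<noteq> 0" "(lie e ^^ Suc m) v = 0"
    "\<beta> (coroot \<alpha>) = of_nat k - 2 * of_nat m"
    "\<forall>j\<le>k. (lie f ^^ j) ((lie e ^^ m) v) \<noteq> 0"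
proof -
  obtain m k :: nat where mk: "(lie e ^^ m) v \<noteq> 0" "(lie e ^^ Suc m) v = 0"
    "\<beta> (lie e f) + of_nat m * \<alpha> (lie e f) = of_nat k * \<alpha> (lie e f) / 2"
    "\<forall>j\<le>k. (lie f ^^ j) ((lie e ^^ m) v) \<noteq> 0"
    by (rule weight_string[OF root_cartan_form[OF \<alpha>] root_nonzero[OF \<alpha>] e f v])
  have "\<beta> (coroot \<alpha>) = of_nat k - 2 * of_nat m"
    using mk(3) unfolding ef root_coroot[OF \<alpha>] by (simp add: algebra_simps)
  then show ?thesis using that mk by blast
qed

lemma highest_weight_nonneg:
  assumes \<alpha>: "\<alpha> \<in> lie_roots \<aa>" and e: "e \<in> root_space \<aa> \<alpha>" "e \<noteq> 0"
    and v: "v \<in> root_space \<aa> \<beta>" "v \<noteq> 0" and 0: "lie e v = 0"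
  obtains k :: nat where "\<beta> (coroot \<alpha>) = of_nat k"
proof -
  obtain f where f: "f \<in> root_space \<aa> (\<lambda>X. - \<alpha> X)" "lie e f = coroot \<alpha>"
    by (rule sl2_triple[OF \<alpha> e])
  obtain m k :: nat where mk: "(lie e ^^ m) v \<noteq> 0" "(lie e ^^ Suc m) v = 0"
    "\<beta> (coroot \<alpha>) = of_nat k - 2 * of_nat m"
    "\<forall>j\<le>k. (lie f ^^ j) ((lie e ^^ m) v) \<noteq> 0"
    by (rule weight_string_coroot[OF \<alpha> e(1) f v])
  have "m = 0"
  proof (rule ccontr)
    assume "m \<noteq> 0"
    then obtain m' where "m = Suc m'" by (cases m) auto
    then have "(lie e ^^ m) v = (lie e ^^ m') (lie e v)" by (simp add: funpow_swap1)
    also have "\<dots> = 0" unfolding 0 by (induction m') simp_all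
    finally show False using mk(1) by simp
  qed
  then show ?thesis using that mk(3) by simp
qed

text \<open>If \<open>\<alpha>\<close> had a second root vector, a combination \<open>x'\<close> of the two would commute with a root
  vector for \<open>-\<alpha>\<close>, and would be a highest weight vector of negative weight \<open>-2\<close>.\<close>

lemma root_space_one_dimensional:
  assumes \<alpha>: "\<alpha> \<in> lie_roots \<aa>" and e: "e \<in> root_space \<aa> \<alpha>" "e \<noteq> 0"
    and x: "x \<in> root_space \<aa> \<alpha>"
  obtains c where "x = c *\<^sub>C e"
proof -
  let ?\<gamma> = "\<lambda>X. - \<alpha> X"
  obtain f where f: "f \<in> root_space \<aa> ?\<gamma>" "killing e f \<noteq> 0"
    by (rule opposite_root_vector[OF root_cartan_form[OF \<alpha>] e])
  have f0: "f \<noteq> 0" using f(2) killing_scale_right[of e 0 0] by auto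
  define x' where "x' = x - (killing x f / killing e f) *\<^sub>C e"
  have x': "x' \<in> root_space \<aa> \<alpha>"
    unfolding x'_def
    by (intro cvec.subspace_diff[OF subspace_root_space] cvec.subspace_scale[OF subspace_root_space]
        x e(1))
  have "killing x' f = 0"
    using f(2) by (simp add: x'_def killing_diff_left killing_scale_left)
  then have "lie x' f = 0"
    using lie_opposite_root_vectors[OF root_cartan_form[OF \<alpha>] x' f(1)] by simp
  then have 0: "lie f x' = 0" using lie_anti[of f x'] by simp
  have "x' = 0"
  proof (rule ccontr)
    assume "x' \<noteq> 0"
    then obtain k :: nat where "\<alpha> (coroot ?\<gamma>) = of_nat k"
      using highest_weight_nonneg[OF root_minus[OF \<alpha>] f(1) f0 x' _ 0] by blast
    moreover have "\<alpha> (coroot ?\<gamma>) = - 2"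
      using coroot_minus[OF \<alpha>] root_coroot[OF \<alpha>] linear_form_scale[OF root_linear[OF \<alpha>], of "-1"]
      by simp
    ultimately have "complex_of_real (real k) = complex_of_real (- 2)" by simp
    then have "real k = - 2" by (simp only: of_real_eq_iff)
    then show False by simp
  qed
  then show ?thesis using that by (simp add: x'_def)
qed

lemma inj_on_wt: "inj_on wt (B - \<aa>)"
proof (rule inj_onI)
  fix b b' assume b: "b \<in> B - \<aa>" "b' \<in> B - \<aa>" and eq: "wt b = wt b'"
  have "wt b \<in> lie_roots \<aa>" using b(1) roots_eq_weights by auto
  then obtain c where c: "b' = c *\<^sub>C b"
  proof (rule root_space_one_dimensional)
    show "b \<in> root_space \<aa> (wt b)" "b \<noteq> 0" "b' \<in> root_space \<aa> (wt b)"
      unfolding eq using b by (simp_all add: basis_in_root_space basis_nonzero flip: eq)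
       (simp add: eq basis_in_root_space)
  qed
  then have "coord b' b' = c * coord b b'" by simp
  then show "b = b'" using b by (auto simp: coord_basis split: if_splits)
qed

text \<open>Otherwise the string through a vector of weight \<open>n * \<alpha>\<close> would contain a vector of
  weight \<open>\<alpha>\<close> that \<open>e\<close> maps to a nonzero vector of weight \<open>2 * \<alpha>\<close>, but this vector
  is a multiple of \<open>e\<close>.\<close>

lemma multiple_not_root:
  assumes \<alpha>: "\<alpha> \<in> lie_roots \<aa>" and n: "n \<ge> 2"
  shows "(\<lambda>X. of_nat n * \<alpha> X) \<notin> lie_roots \<aa>"
proof
  let ?\<beta> = "\<lambda>X. of_nat n * \<alpha> X"
  assume \<beta>: "?\<beta> \<in> lie_roots \<aa>"
  obtain v where v: "v \<in> root_space \<aa> ?\<beta>" "v \<noteq> 0" by (rule root_vector[OF \<beta>])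
  obtain e where e: "e \<in> root_space \<aa> \<alpha>" "e \<noteq> 0" by (rule root_vector[OF \<alpha>])
  obtain f where f: "f \<in> root_space \<aa> (\<lambda>X. - \<alpha> X)" "lie e f = coroot \<alpha>"
    by (rule sl2_triple[OF \<alpha> e])
  obtain m k :: nat where mk: "(lie e ^^ m) v \<noteq> 0" "(lie e ^^ Suc m) v = 0"
    "?\<beta> (coroot \<alpha>) = of_nat k - 2 * of_nat m"
    "\<forall>j\<le>k. (lie f ^^ j) ((lie e ^^ m) v) \<noteq> 0"
    by (rule weight_string_coroot[OF \<alpha> e(1) f v])
  let ?w = "(lie e ^^ m) v"
  have "(of_nat k :: complex) = of_nat (2 * (n + m))"
    using mk(3) root_coroot[OF \<alpha>] by (simp add: algebra_simps)
  then have k: "k = 2 * (n + m)" by (simp only: of_nat_eq_iff)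
  \<comment> \<open>\<open>?w\<close> has weight \<open>(n + m) * \<alpha>\<close>, so the \<open>j\<close>-th step down has weight \<open>2 * \<alpha>\<close>.\<close>
  define j where "j = n + m - 2"
  have j: "Suc (Suc j) = n + m" using n by (simp add: j_def)
  have w: "?w \<in> root_space \<aa> (\<lambda>X. of_nat (n + m) * \<alpha> X)"
    using lie_funpow_root_space[OF e(1) v(1), of m] by (simp add: distrib_right)
  have H: "coroot \<alpha> \<in> \<aa>" using coroot_in[OF \<alpha>] .
  have "lie e ((lie f ^^ Suc j) ?w) =
      ((of_nat j + 1) * (of_nat (n + m) * 2 - of_nat j * 2 / 2)) *\<^sub>C (lie f ^^ j) ?w"
    using mk(2) f w H root_coroot[OF \<alpha>]
    by (intro ladder_formula[THEN conjunct2]) (auto simp: root_space_def)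
  also have "of_nat (n + m) * 2 - of_nat j * 2 / 2 = (of_nat (j + 4) :: complex)"
    by (simp add: j[symmetric])
  also have "(of_nat j + 1) * of_nat (j + 4) = (of_nat (Suc j * (j + 4)) :: complex)"
    by (simp add: algebra_simps)
  finally have 1: "lie e ((lie f ^^ Suc j) ?w) = of_nat (Suc j * (j + 4)) *\<^sub>C (lie f ^^ j) ?w" .
  have "(lie f ^^ j) ?w \<noteq> 0" using mk(4) k j by simp
  moreover have "(of_nat (Suc j * (j + 4)) :: complex) \<noteq> 0" by (simp only: of_nat_eq_0_iff) simp
  ultimately have ne: "lie e ((lie f ^^ Suc j) ?w) \<noteq> 0" unfolding 1 by simp
  have "(\<lambda>X. of_nat (n + m) * \<alpha> X + of_nat (Suc j) * - \<alpha> X) = \<alpha>"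
    unfolding j[symmetric] by (rule ext) (simp add: algebra_simps)
  then have "(lie f ^^ Suc j) ?w \<in> root_space \<aa> \<alpha>"
    using lie_funpow_root_space[OF f(1) w, of "Suc j"] by simp
  then obtain c where "(lie f ^^ Suc j) ?w = c *\<^sub>C e"
    by (rule root_space_one_dimensional[OF \<alpha> e])
  then show False using ne by (simp add: lie_cscale_right lie_self)
qed

definition reflect :: "('g \<Rightarrow> complex) \<Rightarrow> ('g \<Rightarrow> complex) \<Rightarrow> 'g \<Rightarrow> complex" where
  "reflect \<alpha> \<beta> = (\<lambda>X. \<beta> X - \<beta> (coroot \<alpha>) * \<alpha> X)"

lemma reflect_coroot: "\<alpha> \<in> lie_roots \<aa> \<Longrightarrow> reflect \<alpha> \<beta> (coroot \<alpha>) = - \<beta> (coroot \<alpha>)"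
  by (simp add: reflect_def root_coroot)

lemma reflect_reflect: "\<alpha> \<in> lie_roots \<aa> \<Longrightarrow> reflect \<alpha> (reflect \<alpha> \<beta>) = \<beta>"
  by (rule ext) (simp add: reflect_def root_coroot algebra_simps)

lemma reflect_minus:
  "\<alpha> \<in> lie_roots \<aa> \<Longrightarrow> linear_form \<beta> \<Longrightarrow> reflect (\<lambda>X. - \<alpha> X) \<beta> = reflect \<alpha> \<beta>"
  using linear_form_scale[of \<beta> "-1" "coroot \<alpha>"]
  by (simp add: reflect_def coroot_minus)

text \<open>The numbers \<open>m\<close> and \<open>k\<close> come from \<open>weight_string_coroot\<close>. If \<open>\<beta>\<close> is nonnegative on the coroot,
  its mirror image lies \<open>k - m\<close> steps below the top of the \<open>\<alpha>\<close>-string, and the ladder does not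
  stop before \<open>k\<close> steps.\<close>

lemma reflect_root_nonneg:
  assumes \<alpha>: "\<alpha> \<in> lie_roots \<aa>" and \<beta>: "\<beta> \<in> lie_roots \<aa>" and v: "v \<in> root_space \<aa> \<beta>" "v \<noteq> 0"
    and e: "e \<in> root_space \<aa> \<alpha>" and f: "f \<in> root_space \<aa> (\<lambda>X. - \<alpha> X)"
    and k: "\<beta> (coroot \<alpha>) = of_nat k - 2 * of_nat m" "2 * m \<le> k"
      "\<forall>j\<le>k. (lie f ^^ j) ((lie e ^^ m) v) \<noteq> 0"
  shows "reflect \<alpha> \<beta> \<in> lie_roots \<aa>"
proof (rule rootI)
  show "reflect \<alpha> \<beta> \<in> cartan_forms \<aa>"
    unfolding reflect_def
    by (intro cartan_form_diff cartan_form_scale root_cartan_form \<alpha> \<beta>)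
  show "reflect \<alpha> \<beta> \<noteq> (\<lambda>_. 0)"
  proof
    assume 0: "reflect \<alpha> \<beta> = (\<lambda>_. 0)"
    then have "\<beta> (coroot \<alpha>) = 0" using reflect_coroot[OF \<alpha>, of \<beta>] by simp
    then show False using 0 root_nonzero[OF \<beta>] by (simp add: reflect_def)
  qed
  have "(\<lambda>X. (\<beta> X + of_nat m * \<alpha> X) + of_nat (k - m) * - \<alpha> X) = reflect \<alpha> \<beta>"
    using k(2) by (auto simp: reflect_def k(1) fun_eq_iff of_nat_diff algebra_simps)
  then show "(lie f ^^ (k - m)) ((lie e ^^ m) v) \<in> root_space \<aa> (reflect \<alpha> \<beta>)"
    using lie_funpow_root_space[OF f lie_funpow_root_space[OF e v(1), of m], of "k - m"] by simp
  show "(lie f ^^ (k - m)) ((lie e ^^ m) v) \<noteq> 0" using k(3) by simp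
qed

text \<open>If \<open>\<beta>\<close> is negative on the coroot of \<open>\<alpha>\<close>, it is positive on that of \<open>-\<alpha>\<close>, which gives the
  same reflection.\<close>

lemma reflect_root:
  assumes \<alpha>: "\<alpha> \<in> lie_roots \<aa>" and \<beta>: "\<beta> \<in> lie_roots \<aa>"
  shows "reflect \<alpha> \<beta> \<in> lie_roots \<aa>"
proof -
  obtain v where v: "v \<in> root_space \<aa> \<beta>" "v \<noteq> 0" by (rule root_vector[OF \<beta>])
  obtain e where e: "e \<in> root_space \<aa> \<alpha>" "e \<noteq> 0" by (rule root_vector[OF \<alpha>])
  obtain f where f: "f \<in> root_space \<aa> (\<lambda>X. - \<alpha> X)" "lie e f = coroot \<alpha>"
    by (rule sl2_triple[OF \<alpha> e])
  obtain m k :: nat where "(lie e ^^ m) v \<noteq> 0" "(lie e ^^ Suc m) v = 0"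
    and mk: "\<beta> (coroot \<alpha>) = of_nat k - 2 * of_nat m"
    "\<forall>j\<le>k. (lie f ^^ j) ((lie e ^^ m) v) \<noteq> 0"
    by (rule weight_string_coroot[OF \<alpha> e(1) f v])
  show ?thesis
  proof (cases "2 * m \<le> k")
    case True
    then show ?thesis using reflect_root_nonneg[OF \<alpha> \<beta> v e(1) f(1) mk(1) _ mk(2)] by blast
  next
    case False
    let ?\<gamma> = "\<lambda>X. - \<alpha> X"
    have \<gamma>: "?\<gamma> \<in> lie_roots \<aa>" by (rule root_minus[OF \<alpha>])
    obtain e' where e': "e' \<in> root_space \<aa> ?\<gamma>" "e' \<noteq> 0" by (rule root_vector[OF \<gamma>])
    obtain f' where f': "f' \<in> root_space \<aa> (\<lambda>X. - ?\<gamma> X)" "lie e' f' = coroot ?\<gamma>"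
      by (rule sl2_triple[OF \<gamma> e'])
    obtain m' k' :: nat where "(lie e' ^^ m') v \<noteq> 0" "(lie e' ^^ Suc m') v = 0"
      and mk': "\<beta> (coroot ?\<gamma>) = of_nat k' - 2 * of_nat m'"
      "\<forall>j\<le>k'. (lie f' ^^ j) ((lie e' ^^ m') v) \<noteq> 0"
      by (rule weight_string_coroot[OF \<gamma> e'(1) f' v])
    have "\<beta> (coroot ?\<gamma>) = - \<beta> (coroot \<alpha>)"
      using coroot_minus[OF \<alpha>] linear_form_scale[OF root_linear[OF \<beta>], of "-1"] by simp
    then have "(of_nat (k' + k) :: complex) = of_nat (2 * m' + 2 * m)"
      using mk(1) mk'(1) by (simp add: algebra_simps)
    then have "k' + k = 2 * m' + 2 * m" by (simp only: of_nat_eq_iff)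
    then have "2 * m' \<le> k'" using False by simp
    then have "reflect ?\<gamma> \<beta> \<in> lie_roots \<aa>"
      using reflect_root_nonneg[OF \<gamma> \<beta> v e'(1) f'(1) mk'(1) _ mk'(2)] by blast
    then show ?thesis using reflect_minus[OF \<alpha> root_linear[OF \<beta>]] by simp
  qed
qed

text \<open>Cancel \<open>\<beta>\<close> against its mirror image.\<close>

lemma sum_coroot_eq_2:
  assumes \<alpha>: "\<alpha> \<in> lie_roots \<aa>" and Q: "finite Q" "\<alpha> \<in> Q"
    and stable: "\<And>\<beta>. \<beta> \<in> Q \<Longrightarrow> \<beta> \<noteq> \<alpha> \<Longrightarrow> reflect \<alpha> \<beta> \<in> Q \<and> reflect \<alpha> \<beta> \<noteq> \<alpha>"
  shows "(\<Sum>\<beta>\<in>Q. \<beta> (coroot \<alpha>)) = 2"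
proof -
  have "(\<Sum>\<beta>\<in>Q - {\<alpha>}. \<beta> (coroot \<alpha>)) = (\<Sum>\<beta>\<in>Q - {\<alpha>}. - \<beta> (coroot \<alpha>))"
    by (rule sum.reindex_bij_witness[where i = "reflect \<alpha>" and j = "reflect \<alpha>"])
       (use stable in \<open>auto simp: reflect_reflect[OF \<alpha>] reflect_coroot[OF \<alpha>]\<close>)
  then have "(\<Sum>\<beta>\<in>Q - {\<alpha>}. \<beta> (coroot \<alpha>)) = 0" by (simp add: sum_negf)
  then show ?thesis using sum.remove[OF Q, of "\<lambda>\<beta>. \<beta> (coroot \<alpha>)"] root_coroot[OF \<alpha>] by simp
qed

end

section \<open>Positive roots and the grading\<close>

locale graded_root_decomposition = root_decomposition \<aa> B
  for \<aa> B :: "'g::complex_lie_algebra set" +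
  fixes \<Pi> \<Pi>0 \<Pi>1 :: "('g \<Rightarrow> complex) set" and d :: 'g
  assumes simple: "simple_root_system \<aa> \<Pi>"
    and decomp: "\<Pi> = \<Pi>0 \<union> \<Pi>1"
    and d_in: "d \<in> \<aa>"
    and degree_\<Pi>0: "\<And>\<alpha>. \<alpha> \<in> \<Pi>0 \<Longrightarrow> \<alpha> d = 0"
    and degree_\<Pi>1: "\<And>\<alpha>. \<alpha> \<in> \<Pi>1 \<Longrightarrow> \<alpha> d = 1"
begin

abbreviation positive :: "('g \<Rightarrow> complex) set" where
  "positive \<equiv> positive_roots \<aa> \<Pi>"

lemma finite_simple: "finite \<Pi>"
  and simple_root: "\<alpha> \<in> \<Pi> \<Longrightarrow> \<alpha> \<in> lie_roots \<aa>"
  and root_comb: "\<beta> \<in> lie_roots \<aa> \<Longrightarrow> nonneg_comb \<Pi> \<beta> \<or> nonneg_comb \<Pi> (\<lambda>X. - \<beta> X)"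
  using simple by (auto simp: simple_root_system_def)

lemma simple_independent:
  assumes "\<And>X. (\<Sum>\<alpha>\<in>\<Pi>. c \<alpha> * \<alpha> X) = 0" "\<alpha> \<in> \<Pi>"
  shows "c \<alpha> = 0"
  using simple assms unfolding simple_root_system_def by blast

lemma positive_root: "\<beta> \<in> positive \<Longrightarrow> \<beta> \<in> lie_roots \<aa>"
  by (simp add: positive_roots_def)

lemma finite_positive: "finite positive"
  by (rule finite_subset[OF _ finite_roots]) (auto intro: positive_root)

lemma positive_comb:
  assumes "\<beta> \<in> positive"
  obtains n :: "('g \<Rightarrow> complex) \<Rightarrow> nat" where "\<And>X. \<beta> X = (\<Sum>\<alpha>\<in>\<Pi>. of_nat (n \<alpha>) * \<alpha> X)"
  using assms unfolding positive_roots_def nonneg_comb_def by auto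

lemma positive_or_negative:
  assumes "\<beta> \<in> lie_roots \<aa>"
  shows "\<beta> \<in> positive \<or> (\<lambda>X. - \<beta> X) \<in> positive"
  using root_comb[OF assms] root_minus[OF assms] assms by (auto simp: positive_roots_def)

lemma single_coefficient: "\<gamma> \<in> \<Pi> \<Longrightarrow> (\<Sum>\<alpha>\<in>\<Pi>. (if \<alpha> = \<gamma> then c else 0) * \<alpha> X) = c * \<gamma> X"
  for c :: complex
proof -
  assume \<gamma>: "\<gamma> \<in> \<Pi>"
  have "(\<Sum>\<alpha>\<in>\<Pi>. (if \<alpha> = \<gamma> then c else 0) * \<alpha> X) = (\<Sum>\<alpha>\<in>\<Pi>. if \<alpha> = \<gamma> then c * \<gamma> X else 0)"
    by (rule sum.cong) auto
  then show ?thesis using \<gamma> finite_simple by simp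
qed

lemma simple_positive: "\<alpha> \<in> \<Pi> \<Longrightarrow> \<alpha> \<in> positive"
proof -
  assume \<alpha>: "\<alpha> \<in> \<Pi>"
  have "\<alpha> X = (\<Sum>\<gamma>\<in>\<Pi>. of_nat (if \<gamma> = \<alpha> then 1 else 0) * \<gamma> X)" for X
    using single_coefficient[OF \<alpha>, of 1 X] by (simp add: if_distrib[of of_nat] cong: if_cong)
  then have "nonneg_comb \<Pi> \<alpha>"
    unfolding nonneg_comb_def by (intro exI[of _ "\<lambda>\<gamma>. if \<gamma> = \<alpha> then 1 else 0"] ext)
  then show ?thesis using simple_root[OF \<alpha>] by (simp add: positive_roots_def)
qed

lemma positive_minus:
  assumes \<beta>: "\<beta> \<in> positive"
  shows "(\<lambda>X. - \<beta> X) \<notin> positive"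
proof
  assume "(\<lambda>X. - \<beta> X) \<in> positive"
  then obtain m :: "('g \<Rightarrow> complex) \<Rightarrow> nat" where m: "\<And>X. - \<beta> X = (\<Sum>\<alpha>\<in>\<Pi>. of_nat (m \<alpha>) * \<alpha> X)"
    by (rule positive_comb) blast
  obtain n :: "('g \<Rightarrow> complex) \<Rightarrow> nat" where n: "\<And>X. \<beta> X = (\<Sum>\<alpha>\<in>\<Pi>. of_nat (n \<alpha>) * \<alpha> X)"
    by (rule positive_comb[OF \<beta>]) blast
  have "(\<Sum>\<alpha>\<in>\<Pi>. of_nat (n \<alpha> + m \<alpha>) * \<alpha> X) = 0" for X
    by (simp add: distrib_right sum.distrib flip: n m)
  then have "of_nat (n \<alpha> + m \<alpha>) = (0 :: complex)" if "\<alpha> \<in> \<Pi>" for \<alpha>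
    using simple_independent[of "\<lambda>\<alpha>. of_nat (n \<alpha> + m \<alpha>)"] that by blast
  then have "n \<alpha> = 0" if "\<alpha> \<in> \<Pi>" for \<alpha>
    using that by (metis add_is_0 of_nat_eq_0_iff)
  then have "\<beta> = (\<lambda>_. 0)" using n by (auto simp: fun_eq_iff)
  then show False using root_nonzero[OF positive_root[OF \<beta>]] by simp
qed

text \<open>A simple reflection changes only one coefficient, so some other coefficient of a positive
  root \<open>\<beta> \<noteq> \<alpha>\<close> stays positive.\<close>

lemma simple_reflection_positive:
  assumes \<alpha>: "\<alpha> \<in> \<Pi>" and \<beta>: "\<beta> \<in> positive" "\<beta> \<noteq> \<alpha>"
  shows "reflect \<alpha> \<beta> \<in> positive" "reflect \<alpha> \<beta> \<noteq> \<alpha>"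
proof -
  note \<alpha>_root = simple_root[OF \<alpha>] and \<beta>_root = positive_root[OF \<beta>(1)]
  obtain n :: "('g \<Rightarrow> complex) \<Rightarrow> nat" where n: "\<And>X. \<beta> X = (\<Sum>\<gamma>\<in>\<Pi>. of_nat (n \<gamma>) * \<gamma> X)"
    by (rule positive_comb[OF \<beta>(1)]) blast
  have "\<exists>\<gamma>\<in>\<Pi>. \<gamma> \<noteq> \<alpha> \<and> n \<gamma> \<noteq> 0"
  proof (rule ccontr)
    assume "\<not> (\<exists>\<gamma>\<in>\<Pi>. \<gamma> \<noteq> \<alpha> \<and> n \<gamma> \<noteq> 0)"
    then have "\<beta> X = (\<Sum>\<gamma>\<in>\<Pi>. (if \<gamma> = \<alpha> then of_nat (n \<alpha>) else 0) * \<gamma> X)" for X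
      unfolding n by (intro sum.cong) auto
    then have eq: "\<beta> = (\<lambda>X. of_nat (n \<alpha>) * \<alpha> X)"
      unfolding single_coefficient[OF \<alpha>] by (rule ext)
    have "n \<alpha> \<noteq> 0" using eq root_nonzero[OF \<beta>_root] by auto
    moreover have "n \<alpha> \<noteq> 1" using eq \<beta>(2) by auto
    ultimately have "n \<alpha> \<ge> 2" by linarith
    then show False using multiple_not_root[OF \<alpha>_root] \<beta>_root eq by metis
  qed
  then obtain \<gamma> where \<gamma>: "\<gamma> \<in> \<Pi>" "\<gamma> \<noteq> \<alpha>" "n \<gamma> \<noteq> 0" by blast
  have "(\<lambda>X. - reflect \<alpha> \<beta> X) \<notin> positive"
  proof
    assume "(\<lambda>X. - reflect \<alpha> \<beta> X) \<in> positive"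
    then obtain m :: "('g \<Rightarrow> complex) \<Rightarrow> nat"
      where m: "\<And>X. - reflect \<alpha> \<beta> X = (\<Sum>\<gamma>\<in>\<Pi>. of_nat (m \<gamma>) * \<gamma> X)"
      by (rule positive_comb) blast
    let ?c = "\<lambda>\<delta>. of_nat (n \<delta>) + of_nat (m \<delta>) - (if \<delta> = \<alpha> then \<beta> (coroot \<alpha>) else 0)"
    have "(\<Sum>\<delta>\<in>\<Pi>. ?c \<delta> * \<delta> X) = 0" for X
    proof -
      have "(\<Sum>\<delta>\<in>\<Pi>. ?c \<delta> * \<delta> X) = \<beta> X - reflect \<alpha> \<beta> X - \<beta> (coroot \<alpha>) * \<alpha> X"
        using single_coefficient[OF \<alpha>, of "\<beta> (coroot \<alpha>)" X]
        by (simp add: left_diff_distrib distrib_right sum.distrib sum_subtractf flip: n m)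
      then show ?thesis by (simp add: reflect_def)
    qed
    then have "?c \<gamma> = 0" using simple_independent[of ?c \<gamma>] \<gamma>(1) by blast
    then have "of_nat (n \<gamma> + m \<gamma>) = (0::complex)" using \<gamma>(2) by simp
    then show False using \<gamma>(3) by (simp only: of_nat_eq_0_iff)
  qed
  then show "reflect \<alpha> \<beta> \<in> positive"
    using positive_or_negative[OF reflect_root[OF \<alpha>_root \<beta>_root]] by blast
  show "reflect \<alpha> \<beta> \<noteq> \<alpha>"
  proof
    assume "reflect \<alpha> \<beta> = \<alpha>"
    then have "\<beta> = reflect \<alpha> \<alpha>" using reflect_reflect[OF \<alpha>_root, of \<beta>] by simp
    then have "\<beta> = (\<lambda>X. - \<alpha> X)" by (simp add: reflect_def root_coroot[OF \<alpha>_root])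
    then show False using positive_minus[OF simple_positive[OF \<alpha>]] \<beta>(1) by simp
  qed
qed

lemma positive_degree:
  assumes "\<beta> \<in> positive"
  obtains k :: nat where "\<beta> d = of_nat k"
proof -
  obtain n :: "('g \<Rightarrow> complex) \<Rightarrow> nat" where n: "\<And>X. \<beta> X = (\<Sum>\<gamma>\<in>\<Pi>. of_nat (n \<gamma>) * \<gamma> X)"
    by (rule positive_comb[OF assms]) blast
  have "\<beta> d = (\<Sum>\<gamma>\<in>\<Pi>. of_nat (if \<gamma> \<in> \<Pi>1 then n \<gamma> else 0))"
    unfolding n by (rule sum.cong) (use decomp degree_\<Pi>0 degree_\<Pi>1 in auto)
  also have "\<dots> = of_nat (\<Sum>\<gamma>\<in>\<Pi>. if \<gamma> \<in> \<Pi>1 then n \<gamma> else 0)" by simp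
  finally show ?thesis by (rule that)
qed

lemma grade0_positive_eq: "grade0_positive_roots \<aa> \<Pi> d = {\<beta> \<in> positive. \<beta> d = 0}"
proof -
  have "root_space \<aa> \<beta> \<subseteq> grade_space d 0 \<longleftrightarrow> \<beta> d = 0" if \<beta>: "\<beta> \<in> positive" for \<beta>
  proof
    assume sub: "root_space \<aa> \<beta> \<subseteq> grade_space d 0"
    obtain e where e: "e \<in> root_space \<aa> \<beta>" "e \<noteq> 0" by (rule root_vector[OF positive_root[OF \<beta>]])
    have "lie d e = 0" using sub e(1) by (auto simp: grade_space_def)
    moreover have "lie d e = \<beta> d *\<^sub>C e" using e(1) d_in by (simp add: root_space_def)
    ultimately show "\<beta> d = 0" using e(2) by simp
  qed (use d_in in \<open>auto simp: root_space_def grade_space_def\<close>)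
  then show ?thesis by (auto simp: grade0_positive_roots_def)
qed

lemma sum_positive_coroot:
  assumes \<alpha>: "\<alpha> \<in> \<Pi>"
  shows "(\<Sum>\<beta>\<in>positive. \<beta> (coroot \<alpha>)) = 2"
  by (rule sum_coroot_eq_2[OF simple_root[OF \<alpha>] finite_positive simple_positive[OF \<alpha>]])
     (use simple_reflection_positive[OF \<alpha>] in blast)

lemma delta_h_coroot_\<Pi>0:
  assumes \<alpha>: "\<alpha> \<in> \<Pi>0"
  shows "delta_h \<aa> \<Pi> d (coroot \<alpha>) = 2"
proof -
  have \<alpha>': "\<alpha> \<in> \<Pi>" using \<alpha> decomp by blast
  show ?thesis
    unfolding delta_h_def grade0_positive_eq
  proof (rule sum_coroot_eq_2[OF simple_root[OF \<alpha>']])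
    show "reflect \<alpha> \<beta> \<in> {\<beta> \<in> positive. \<beta> d = 0} \<and> reflect \<alpha> \<beta> \<noteq> \<alpha>"
      if "\<beta> \<in> {\<beta> \<in> positive. \<beta> d = 0}" "\<beta> \<noteq> \<alpha>" for \<beta>
      using that simple_reflection_positive[OF \<alpha>', of \<beta>] degree_\<Pi>0[OF \<alpha>]
      by (simp add: reflect_def)
  qed (use \<alpha> \<alpha>' in \<open>simp_all add: finite_positive simple_positive degree_\<Pi>0\<close>)
qed

text \<open>\<open>\<beta> - \<alpha>\<close> is not a root: its degree \<open>-1\<close> would make it negative, and then \<open>\<beta>\<close> would be a
  multiple of \<open>\<alpha>\<close>, of nonzero degree. So a root vector of \<open>\<beta>\<close> has highest weight for the root \<open>-\<alpha>\<close>.\<close>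

lemma grade0_root_coroot_\<Pi>1:
  assumes \<alpha>: "\<alpha> \<in> \<Pi>1" and \<beta>: "\<beta> \<in> positive" "\<beta> d = 0"
  obtains k :: nat where "\<beta> (coroot \<alpha>) = - of_nat k"
proof -
  let ?\<gamma> = "\<lambda>X. - \<alpha> X" and ?\<mu> = "\<lambda>X. - \<alpha> X + \<beta> X"
  have \<alpha>': "\<alpha> \<in> \<Pi>" using \<alpha> decomp by blast
  note \<alpha>_root = simple_root[OF \<alpha>'] and \<beta>_root = positive_root[OF \<beta>(1)]
  have "?\<mu> \<notin> lie_roots \<aa>"
  proof
    assume "?\<mu> \<in> lie_roots \<aa>"
    moreover have "?\<mu> \<notin> positive"
    proof
      assume "?\<mu> \<in> positive"
      then obtain k :: nat where "?\<mu> d = of_nat k" by (rule positive_degree)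
      then have "complex_of_real (real k) = complex_of_real (- 1)"
        using degree_\<Pi>1[OF \<alpha>] \<beta>(2) by simp
      then have "real k = - 1" by (simp only: of_real_eq_iff)
      then show False by simp
    qed
    ultimately have "(\<lambda>X. - ?\<mu> X) \<in> positive" using positive_or_negative by blast
    then obtain m :: "('g \<Rightarrow> complex) \<Rightarrow> nat"
      where m: "\<And>X. - ?\<mu> X = (\<Sum>\<gamma>\<in>\<Pi>. of_nat (m \<gamma>) * \<gamma> X)"
      by (rule positive_comb) blast
    obtain n :: "('g \<Rightarrow> complex) \<Rightarrow> nat" where n: "\<And>X. \<beta> X = (\<Sum>\<gamma>\<in>\<Pi>. of_nat (n \<gamma>) * \<gamma> X)"
      by (rule positive_comb[OF \<beta>(1)]) blast
    let ?c = "\<lambda>\<delta>. of_nat (n \<delta>) + of_nat (m \<delta>) - (if \<delta> = \<alpha> then 1 else 0) :: complex"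
    have "(\<Sum>\<delta>\<in>\<Pi>. ?c \<delta> * \<delta> X) = 0" for X
      using single_coefficient[OF \<alpha>', of 1 X]
      by (simp add: left_diff_distrib distrib_right sum.distrib sum_subtractf flip: n m)
    then have c: "?c \<delta> = 0" if "\<delta> \<in> \<Pi>" for \<delta>
      using simple_independent[of ?c \<delta>] that by blast
    have n0: "n \<delta> = 0" if "\<delta> \<in> \<Pi>" "\<delta> \<noteq> \<alpha>" for \<delta>
    proof -
      have "of_nat (n \<delta> + m \<delta>) = (0::complex)" using c[OF that(1)] that(2) by simp
      then show ?thesis by (simp only: of_nat_eq_0_iff)
    qed
    have "\<beta> X = (\<Sum>\<delta>\<in>\<Pi>. (if \<delta> = \<alpha> then of_nat (n \<alpha>) else 0) * \<delta> X)" for X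
      unfolding n by (rule sum.cong) (use n0 in auto)
    then have eq: "\<beta> X = of_nat (n \<alpha>) * \<alpha> X" for X by (simp add: single_coefficient[OF \<alpha>'])
    then have "of_nat (n \<alpha>) = (0::complex)" using \<beta>(2) degree_\<Pi>1[OF \<alpha>] by simp
    then have "\<beta> = (\<lambda>_. 0)" using eq by (auto simp: fun_eq_iff)
    then show False using root_nonzero[OF \<beta>_root] by simp
  qed
  obtain e where e: "e \<in> root_space \<aa> ?\<gamma>" "e \<noteq> 0" by (rule root_vector[OF root_minus[OF \<alpha>_root]])
  obtain v where v: "v \<in> root_space \<aa> \<beta>" "v \<noteq> 0" by (rule root_vector[OF \<beta>_root])
  have "?\<mu> d \<noteq> 0" using degree_\<Pi>1[OF \<alpha>] \<beta>(2) by simp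
  then have "?\<mu> \<noteq> (\<lambda>_. 0)" by metis
  then have "lie e v = 0"
    using rootI[OF cartan_form_add[OF cartan_form_minus[OF root_cartan_form[OF \<alpha>_root]]
          root_cartan_form[OF \<beta>_root]] _ lie_root_space[OF e(1) v(1)]] \<open>?\<mu> \<notin> lie_roots \<aa>\<close>
    by blast
  then obtain k :: nat where k: "\<beta> (coroot ?\<gamma>) = of_nat k"
    by (rule highest_weight_nonneg[OF root_minus[OF \<alpha>_root] e v])
  have "\<beta> (coroot ?\<gamma>) = - \<beta> (coroot \<alpha>)"
    using coroot_minus[OF \<alpha>_root] linear_form_scale[OF root_linear[OF \<beta>_root], of "-1"] by simp
  then have "\<beta> (coroot \<alpha>) = - of_nat k" using k by simp
  then show ?thesis by (rule that)
qed

lemma delta_h_coroot_\<Pi>1: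
  assumes \<alpha>: "\<alpha> \<in> \<Pi>1"
  obtains k :: nat where "delta_h \<aa> \<Pi> d (coroot \<alpha>) = - of_nat k"
proof -
  have "\<forall>\<beta>\<in>{\<beta> \<in> positive. \<beta> d = 0}. \<exists>k::nat. \<beta> (coroot \<alpha>) = - of_nat k"
    using grade0_root_coroot_\<Pi>1[OF \<alpha>] by blast
  then obtain k :: "('g \<Rightarrow> complex) \<Rightarrow> nat"
    where k: "\<forall>\<beta>\<in>{\<beta> \<in> positive. \<beta> d = 0}. \<beta> (coroot \<alpha>) = - of_nat (k \<beta>)"
    by (rule bchoice[THEN exE])
  have "delta_h \<aa> \<Pi> d (coroot \<alpha>) = (\<Sum>\<beta> | \<beta> \<in> positive \<and> \<beta> d = 0. - of_nat (k \<beta>))"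
    unfolding delta_h_def grade0_positive_eq by (rule sum.cong[OF refl]) (rule bspec[OF k])
  also have "\<dots> = - of_nat (\<Sum>\<beta> | \<beta> \<in> positive \<and> \<beta> d = 0. k \<beta>)" by (simp add: sum_negf)
  finally show ?thesis by (rule that)
qed

text \<open>By duality the roots in \<open>\<Pi>\<close>, hence all roots, vanish on the dual vector of \<open>\<omega>\<close>.\<close>

lemma coroots_separate:
  assumes \<omega>: "linear_form \<omega>" and 0: "\<And>\<alpha>. \<alpha> \<in> \<Pi> \<Longrightarrow> \<omega> (coroot \<alpha>) = 0" and H: "H \<in> \<aa>"
  shows "\<omega> H = 0"
proof -
  let ?T = "dual_vector \<aa> \<omega>"
  have T: "?T \<in> \<aa>" by (rule dual_vector_in[OF \<omega>])
  have \<Pi>0: "\<alpha> ?T = 0" if \<alpha>: "\<alpha> \<in> \<Pi>" for \<alpha>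
  proof -
    note lin = root_linear[OF simple_root[OF \<alpha>]]
    have "\<omega> (dual_vector \<aa> \<alpha>) = 0"
      using 0[OF \<alpha>] root_dual_vector_nonzero[OF simple_root[OF \<alpha>]]
      by (simp add: coroot_def linear_form_scale[OF \<omega>])
    then have "killing ?T (dual_vector \<aa> \<alpha>) = 0"
      using killing_dual_vector[OF \<omega> dual_vector_in[OF lin]] by simp
    then show ?thesis
      using killing_dual_vector[OF lin T] by (simp add: killing_sym)
  qed
  have pos: "\<beta> ?T = 0" if "\<beta> \<in> positive" for \<beta>
    by (rule positive_comb[OF that]) (simp add: \<Pi>0)
  have "?T = 0"
  proof (rule cartan_eq_0_of_roots[OF T])
    fix \<beta> assume "\<beta> \<in> lie_roots \<aa>"
    then show "\<beta> ?T = 0" using positive_or_negative pos[of \<beta>] pos[of "\<lambda>X. - \<beta> X"] by auto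
  qed
  then show ?thesis using killing_dual_vector[OF \<omega> H] killing_scale_left[of 0 0 H] by simp
qed

section \<open>The Koszul form\<close>

text \<open>The degrees are integers, so the real part carries the sign.\<close>

definition grade_sign :: "complex \<Rightarrow> complex" where
  "grade_sign z = of_real (sgn (Re z))"

definition grade_sign_endo :: "'g \<Rightarrow> 'g" where
  "grade_sign_endo x = (\<Sum>b\<in>B. (coord x b * grade_sign (wt b d)) *\<^sub>C b)"

lemma coord_grade_sign_endo:
  "b \<in> B \<Longrightarrow> coord (grade_sign_endo x) b = coord x b * grade_sign (wt b d)"
  unfolding grade_sign_endo_def using coord_combination[OF subset_refl] by simp

lemma linear_grade_sign_endo: "linear_endo grade_sign_endo"
  by (rule linear_endoI)
     (simp_all add: grade_sign_endo_def distrib_right cvec.scale_left_distrib sum.distrib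
       cvec.scale_sum_right mult.assoc)

lemma grade_sign_endo_eigen:
  assumes "lie d x = c *\<^sub>C x"
  shows "grade_sign_endo x = grade_sign c *\<^sub>C x"
proof (rule coord_eqI)
  fix b assume b: "b \<in> B"
  have "wt b d * coord x b = c * coord x b"
    using coord_lie_cartan[OF d_in b, of x] by (simp only: assms coord_scale)
  then have "coord x b = 0 \<or> c = wt b d" by auto
  then show "coord (grade_sign_endo x) b = coord (grade_sign c *\<^sub>C x) b"
    using b by (auto simp: coord_grade_sign_endo)
qed

lemma weight_degree_int:
  assumes "b \<in> B"
  obtains z :: int where "wt b d = of_int z"
proof (cases "b \<in> \<aa>")
  case True
  then show ?thesis using that[of 0] wt_zero_iff[OF assms] by simp
next
  case False
  then have root: "wt b \<in> lie_roots \<aa>" using assms roots_eq_weights by auto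
  show ?thesis
  proof (cases "wt b \<in> positive")
    case True
    then obtain k :: nat where "wt b d = of_nat k" by (rule positive_degree)
    then show ?thesis using that[of "int k"] by simp
  next
    case False
    then have "(\<lambda>X. - wt b X) \<in> positive" using positive_or_negative[OF root] by blast
    then obtain k :: nat where k: "- wt b d = of_nat k" by (rule positive_degree)
    have "wt b d = - (- wt b d)" by simp
    also have "\<dots> = of_int (- int k)" by (simp add: k)
    finally show ?thesis by (rule that)
  qed
qed

text \<open>Uniqueness is where the integrality of the degrees enters: every basis vector lies in one of the
  three spaces on which the endomorphism is prescribed.\<close>

lemma para_endo_eq: "para_endo d = grade_sign_endo"
  unfolding para_endo_def
proof (rule the_equality)
  interpret K: Vector_Spaces.linear "(*\<^sub>C)" "(*\<^sub>C)" grade_sign_endo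
    by (rule linear_grade_sign_endo)
  have sign: "grade_sign (of_int p) = of_int (sgn p)" for p
    by (simp add: grade_sign_def sgn_if)
  have eigen: "grade_sign_endo x = of_int (sgn p) *\<^sub>C x" if "x \<in> grade_space d p" for x p
    using grade_sign_endo_eigen[of x "of_int p"] that by (simp add: grade_space_def sign)
  have on_span: "grade_sign_endo x = c *\<^sub>C x"
    if "x \<in> cvec.span X" "\<And>y. y \<in> X \<Longrightarrow> grade_sign_endo y = c *\<^sub>C y" for x c X
    using that(1)
  proof (induction rule: cvec.span_induct_alt)
    case (step k y z)
    then show ?case using that(2)
      by (simp add: K.add K.scale cvec.scale_right_distrib cvec.scale_left_commute)
  qed (simp add: K.zero)
  have neg: "grade_sign_endo x = (- 1) *\<^sub>C x" if "x \<in> grade_neg d" for x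
    using that unfolding grade_neg_def
  proof (rule on_span)
    fix y assume "y \<in> (\<Union>p\<in>{0<..}. grade_space d (- p))"
    then obtain p where "0 < p" "y \<in> grade_space d (- p)" by auto
    then show "grade_sign_endo y = (- 1) *\<^sub>C y" using eigen[of y "- p"] by simp
  qed
  have pos: "grade_sign_endo x = 1 *\<^sub>C x" if "x \<in> grade_pos d" for x
    using that unfolding grade_pos_def
  proof (rule on_span)
    fix y assume "y \<in> (\<Union>p\<in>{0<..}. grade_space d p)"
    then obtain p where "0 < p" "y \<in> grade_space d p" by auto
    then show "grade_sign_endo y = 1 *\<^sub>C y" using eigen[of y p] by simp
  qed
  show "linear_endo grade_sign_endo \<and> (\<forall>X\<in>grade_space d 0. grade_sign_endo X = 0) \<and>
      (\<forall>X\<in>grade_pos d. grade_sign_endo X = X) \<and> (\<forall>X\<in>grade_neg d. grade_sign_endo X = - X)"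
    using linear_grade_sign_endo eigen[of _ 0] pos neg by simp
  fix K' assume K': "linear_endo K' \<and> (\<forall>X\<in>grade_space d 0. K' X = 0) \<and>
      (\<forall>X\<in>grade_pos d. K' X = X) \<and> (\<forall>X\<in>grade_neg d. K' X = - X)"
  interpret K': Vector_Spaces.linear "(*\<^sub>C)" "(*\<^sub>C)" K' using K' by blast
  have basis: "K' b = grade_sign_endo b" if b: "b \<in> B" for b
  proof -
    obtain z :: int where z: "wt b d = of_int z" by (rule weight_degree_int[OF b])
    have bz: "b \<in> grade_space d z" using lie_wt[OF b d_in] z by (simp add: grade_space_def)
    consider "z = 0" | "z > 0" | "z < 0" by linarith
    then show ?thesis
    proof cases
      case 1
      then show ?thesis using K' bz eigen[OF bz] by simp
    next
      case 2
      then have "b \<in> grade_pos d"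
        unfolding grade_pos_def using bz by (intro cvec.span_base) auto
      then show ?thesis using K' pos by simp
    next
      case 3
      then have "b \<in> grade_neg d"
        unfolding grade_neg_def using bz by (intro cvec.span_base UN_I[of "- z"]) auto
      then show ?thesis using K' neg by simp
    qed
  qed
  show "K' = grade_sign_endo"
  proof
    fix x
    have "K' x = (\<Sum>b\<in>B. coord x b *\<^sub>C K' b)"
      by (subst basis_expansion[of x]) (simp add: K'.sum K'.scale)
    also have "\<dots> = (\<Sum>b\<in>B. coord x b *\<^sub>C grade_sign_endo b)"
      by (rule sum.cong) (simp_all add: basis)
    also have "\<dots> = grade_sign_endo x"
      by (subst (2) basis_expansion[of x]) (simp add: K.sum K.scale)
    finally show "K' x = grade_sign_endo x" .
  qed
qed

lemma grade_space_0_span: "grade_space d 0 = cvec.span {b \<in> B. wt b d = 0}"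
proof (intro set_eqI)
  fix x
  have "x \<in> grade_space d 0 \<longleftrightarrow> lie d x = 0" by (simp add: grade_space_def)
  also have "\<dots> \<longleftrightarrow> (\<forall>b\<in>B. coord (lie d x) b = 0)" using coord_eqI[of "lie d x" 0] by auto
  also have "\<dots> \<longleftrightarrow> (\<forall>b\<in>B. wt b d = 0 \<or> coord x b = 0)" by (simp add: coord_lie_cartan[OF d_in])
  also have "\<dots> \<longleftrightarrow> (\<forall>b\<in>B - {b \<in> B. wt b d = 0}. coord x b = 0)" by auto
  also have "\<dots> \<longleftrightarrow> x \<in> cvec.span {b \<in> B. wt b d = 0}" by (subst in_span_iff_coord) auto
  finally show "x \<in> grade_space d 0 \<longleftrightarrow> x \<in> cvec.span {b \<in> B. wt b d = 0}" .
qed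

text \<open>The endomorphism in the definition of the Koszul form even vanishes on elements of degree
  zero: bracketing with them preserves the degree, hence commutes with \<open>grade_sign_endo\<close>.\<close>

lemma grade_sign_endo_commute:
  assumes Y: "Y \<in> grade_space d 0"
  shows "lie (grade_sign_endo X) Y = grade_sign_endo (lie X Y)"
proof -
  interpret K: Vector_Spaces.linear "(*\<^sub>C)" "(*\<^sub>C)" grade_sign_endo
    by (rule linear_grade_sign_endo)
  have basis: "lie (grade_sign_endo b) Y = grade_sign_endo (lie b Y)" if b: "b \<in> B" for b
  proof -
    have bY: "lie d (lie b Y) = wt b d *\<^sub>C lie b Y"
      using Y lie_wt[OF b d_in]
      by (simp add: lie_derivation[of d b Y] grade_space_def lie_cscale_left)
    show ?thesis
      unfolding grade_sign_endo_eigen[OF lie_wt[OF b d_in]] grade_sign_endo_eigen[OF bY]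
      by (rule lie_cscale_left)
  qed
  have "lie (grade_sign_endo X) Y = (\<Sum>b\<in>B. coord X b *\<^sub>C lie (grade_sign_endo b) Y)"
    by (subst basis_expansion[of X]) (simp add: K.sum K.scale lie_sum_left lie_cscale_left)
  also have "\<dots> = (\<Sum>b\<in>B. coord X b *\<^sub>C grade_sign_endo (lie b Y))"
    by (rule sum.cong) (simp_all add: basis)
  also have "\<dots> = grade_sign_endo (lie X Y)"
    by (subst (2) basis_expansion[of X]) (simp add: K.sum K.scale lie_sum_left lie_cscale_left)
  finally show ?thesis .
qed

lemma koszul_form_coord:
  "koszul_form d X = - (\<Sum>b | b \<in> B \<and> wt b d \<noteq> 0.
      coord (lie (grade_sign_endo X) b) b - coord (lie X b) b * grade_sign (wt b d))"
proof -
  interpret K: Vector_Spaces.linear "(*\<^sub>C)" "(*\<^sub>C)" grade_sign_endo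
    by (rule linear_grade_sign_endo)
  let ?A = "\<lambda>Y. lie (grade_sign_endo X) Y - grade_sign_endo (lie X Y)"
  let ?B0 = "{b \<in> B. wt b d = 0}"
  have sub: "?B0 \<subseteq> B" and BB0: "B - ?B0 = {b. b \<in> B \<and> wt b d \<noteq> 0}" by auto
  have "linear_endo ?A"
    by (rule linear_endoI)
       (simp_all add: lie_add_right lie_cscale_right K.add K.scale cvec.scale_right_diff_distrib)
  moreover have "?A ` cvec.span ?B0 \<subseteq> cvec.span ?B0"
    using grade_sign_endo_commute cvec.span_zero by (auto simp: grade_space_0_span)
  ultimately have "quot_trace (cvec.span ?B0) ?A =
      (\<Sum>b\<in>B - ?B0. quot_coord (cvec.span ?B0) (B - ?B0) (?A b) b)"
    by (intro quot_trace_eq quot_basis_span sub) simp_all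
  also have "\<dots> = (\<Sum>b\<in>B - ?B0. coord (?A b) b)"
    by (rule sum.cong[OF refl quot_coord_span[OF sub]])
  finally show ?thesis
    unfolding koszul_form_def para_endo_eq grade_space_0_span BB0
    by (simp add: coord_grade_sign_endo)
qed

text \<open>Bracketing with a root vector shifts the weights, so it has no diagonal entries.\<close>

lemma koszul_cartan_form: "koszul_form d \<in> cartan_forms \<aa>"
  unfolding cartan_forms_def
proof (intro CollectI conjI allI impI ballI)
  interpret K: Vector_Spaces.linear "(*\<^sub>C)" "(*\<^sub>C)" grade_sign_endo
    by (rule linear_grade_sign_endo)
  show "linear_form (koszul_form d)"
    by (rule linear_formI; unfold koszul_form_coord)
       (simp_all add: K.add K.scale lie_add_left lie_cscale_left sum_distrib_left
         algebra_simps flip: sum.distrib sum_negf)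
  fix \<nu> X
  assume \<nu>: "linear_form \<nu> \<and> (\<exists>H\<in>\<aa>. \<nu> H \<noteq> 0)" and X: "X \<in> root_space \<aa> \<nu>"
  have off: "coord (lie X b) b = 0" if b: "b \<in> B" for b
  proof (rule ccontr)
    assume ne: "coord (lie X b) b \<noteq> 0"
    obtain H where "H \<in> \<aa>" "\<nu> H \<noteq> 0" using \<nu> by blast
    then show False
      using root_space_coord[OF lie_root_space[OF X basis_in_root_space[OF b]] b ne] by simp
  qed
  have "lie d X = \<nu> d *\<^sub>C X" using X d_in by (simp add: root_space_def)
  from grade_sign_endo_eigen[OF this] show "koszul_form d X = 0"
    unfolding koszul_form_coord by (simp add: lie_cscale_left off)
qed

text \<open>On \<open>\<aa>\<close> the Koszul form is the sum over all roots, each with the sign of its degree. Opposite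
  roots contribute the same, which explains the factor \<open>2\<close>, and the positive roots of degree zero
  contribute nothing.\<close>

lemma koszul_form_cartan:
  assumes H: "H \<in> \<aa>"
  shows "koszul_form d H = 2 * ((\<Sum>\<beta>\<in>positive. \<beta> H) - delta_h \<aa> \<Pi> d H)"
proof -
  let ?g = "\<lambda>\<beta>. \<beta> H * grade_sign (\<beta> d)"
  have "grade_sign_endo H = 0"
    using grade_sign_endo_eigen[of H 0] cartan_commute[OF d_in H] by (simp add: grade_sign_def)
  then have "koszul_form d H = (\<Sum>b | b \<in> B \<and> wt b d \<noteq> 0. ?g (wt b))"
    unfolding koszul_form_coord sum_negf[symmetric]
    by (intro sum.cong) (simp_all add: lie_wt[OF _ H] coord_basis)
  also have "\<dots> = (\<Sum>b\<in>B - \<aa>. ?g (wt b))"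
  proof (rule sum.mono_neutral_left)
    have "wt b = (\<lambda>_. 0)" if "b \<in> B" "b \<in> \<aa>" for b using wt_zero_iff that by blast
    then show "{b. b \<in> B \<and> wt b d \<noteq> 0} \<subseteq> B - \<aa>" by fastforce
  qed (use finite_B in \<open>auto simp: grade_sign_def\<close>)
  also have "\<dots> = (\<Sum>\<beta>\<in>lie_roots \<aa>. ?g \<beta>)"
    unfolding roots_eq_weights by (simp add: sum.reindex[OF inj_on_wt])
  also have "lie_roots \<aa> = positive \<union> (\<lambda>\<beta> X. - \<beta> X) ` positive"
  proof (intro equalityI subsetI)
    fix \<beta> assume \<beta>: "\<beta> \<in> lie_roots \<aa>"
    show "\<beta> \<in> positive \<union> (\<lambda>\<beta> X. - \<beta> X) ` positive"
    proof (cases "\<beta> \<in> positive")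
      case False
      then have "(\<lambda>X. - \<beta> X) \<in> positive" using positive_or_negative[OF \<beta>] by blast
      then have "(\<lambda>\<beta> X. - \<beta> X) (\<lambda>X. - \<beta> X) \<in> (\<lambda>\<beta> X. - \<beta> X) ` positive" by (rule imageI)
      then show ?thesis by simp
    qed simp
  qed (auto intro: positive_root root_minus)
  also have "(\<Sum>\<beta>\<in>positive \<union> (\<lambda>\<beta> X. - \<beta> X) ` positive. ?g \<beta>) =
      (\<Sum>\<beta>\<in>positive. ?g \<beta>) + (\<Sum>\<beta>\<in>(\<lambda>\<beta> X. - \<beta> X) ` positive. ?g \<beta>)"
    by (rule sum.union_disjoint) (use finite_positive positive_minus in auto)
  also have "(\<Sum>\<beta>\<in>(\<lambda>\<beta> X. - \<beta> X) ` positive. ?g \<beta>) = (\<Sum>\<beta>\<in>positive. ?g \<beta>)"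
    by (subst sum.reindex) (auto simp: inj_on_def fun_eq_iff grade_sign_def sgn_minus)
  also have "(\<Sum>\<beta>\<in>positive. ?g \<beta>) = (\<Sum>\<beta>\<in>positive. \<beta> H - (if \<beta> d = 0 then \<beta> H else 0))"
  proof (rule sum.cong[OF refl])
    fix \<beta> assume "\<beta> \<in> positive"
    then obtain k :: nat where "\<beta> d = of_nat k" by (rule positive_degree)
    then show "?g \<beta> = \<beta> H - (if \<beta> d = 0 then \<beta> H else 0)" by (simp add: grade_sign_def)
  qed
  also have "\<dots> = (\<Sum>\<beta>\<in>positive. \<beta> H) - (\<Sum>\<beta> | \<beta> \<in> positive \<and> \<beta> d = 0. \<beta> H)"
    by (simp add: sum_subtractf sum.inter_filter[OF finite_positive])
  finally show ?thesis by (simp add: delta_h_def grade0_positive_eq)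
qed

lemma delta_h_cartan_form: "delta_h \<aa> \<Pi> d \<in> cartan_forms \<aa>"
  unfolding delta_h_def grade0_positive_eq
  by (rule cartan_form_sum) (auto intro: root_cartan_form positive_root)

end

section \<open>The Koszul form in terms of fundamental weights\<close>

theorem proposition7p8:
  fixes \<aa> :: "'g::complex_lie_algebra set"
    and \<Pi> \<Pi>0 \<Pi>1 P1 :: "('g \<Rightarrow> complex) set"
    and \<alpha> \<pi> :: "nat \<Rightarrow> 'g \<Rightarrow> complex"
    and d :: 'g
    and \<iota> :: "nat \<Rightarrow> nat"
    and l r :: nat
    and a b :: "nat \<Rightarrow> complex"
    and n :: "('g \<Rightarrow> complex) \<Rightarrow> complex"
  assumes semisimple: "semisimple_lie_algebra TYPE('g)"
    and cartan: "cartan_subalgebra \<aa>"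
    and simple_roots: "simple_root_system \<aa> \<Pi>"
    and enum: "bij_betw \<alpha> {1..l} \<Pi>"
    and decomp: "\<Pi> = \<Pi>0 \<union> \<Pi>1" "\<Pi>0 \<inter> \<Pi>1 = {}"
    and grading: "d \<in> \<aa>" "\<forall>\<beta>\<in>\<Pi>0. \<beta> d = 0" "\<forall>\<beta>\<in>\<Pi>1. \<beta> d = 1"
    and weight_form: "\<forall>i\<in>{1..l}. \<pi> i \<in> cartan_forms \<aa>"
    and weight: "\<forall>i\<in>{1..l}. \<forall>j\<in>{1..l}.
        2 * (form_inner \<aa> (\<pi> i) (\<alpha> j) / form_inner \<aa> (\<alpha> j) (\<alpha> j)) = (if i = j then 1 else 0)"
    and enum1: "bij_betw \<iota> {1..r} {j \<in> {1..l}. \<alpha> j \<in> \<Pi>1}"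
    and P1: "P1 = {\<pi> (\<iota> h) | h. h \<in> {1..r}}"
    and b: "\<forall>h\<in>{1..r}. b (\<iota> h) =
        - 2 * (form_inner \<aa> (delta_h \<aa> \<Pi> d) (\<alpha> (\<iota> h)) / form_inner \<aa> (\<alpha> (\<iota> h)) (\<alpha> (\<iota> h)))"
    and a: "\<forall>h\<in>{1..r}. a (\<iota> h) = 2 + b (\<iota> h)"
    and n: "\<forall>h\<in>{1..r}. n (\<pi> (\<iota> h)) = a (\<iota> h)"
  shows "koszul_form d = (\<lambda>X. 2 * (\<Sum>\<omega>\<in>P1. n \<omega> * \<omega> X)) \<and>
    koszul_form d = (\<lambda>X. 2 * (\<Sum>h=1..r. a (\<iota> h) * \<pi> (\<iota> h) X)) \<and>
    (\<forall>h\<in>{1..r}. b (\<iota> h) \<in> \<real> \<and> 0 \<le> Re (b (\<iota> h)))"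
proof -
  obtain B where B: "finite B" "cvec.independent B" "cvec.span B = UNIV"
    "\<And>b H. b \<in> B \<Longrightarrow> H \<in> \<aa> \<Longrightarrow> \<exists>c. lie H b = c *\<^sub>C b"
    by (rule weight_basis_exists[OF cartan]) blast
  interpret graded_root_decomposition \<aa> B \<Pi> \<Pi>0 \<Pi>1 d
    using semisimple cartan B simple_roots decomp(1) grading by unfold_locales blast+
  let ?\<delta> = "delta_h \<aa> \<Pi> d"
  have root: "\<alpha> j \<in> lie_roots \<aa>" if "j \<in> {1..l}" for j
    using that enum by (auto simp: bij_betw_def intro: simple_root)
  have \<iota>: "\<iota> h \<in> {1..l}" "\<alpha> (\<iota> h) \<in> \<Pi>1" if "h \<in> {1..r}" for h
    using that enum1 by (auto simp: bij_betw_def)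
  have inj_\<iota>: "inj_on \<iota> {1..r}" using enum1 by (rule bij_betw_imp_inj_on)
  have \<pi>_coroot: "\<pi> i (coroot (\<alpha> j)) = (if i = j then 1 else 0)" if "i \<in> {1..l}" "j \<in> {1..l}" for i j
    using weight that form_inner_coroot[OF root[OF that(2)] cartan_form_linear, of "\<pi> i"] weight_form
    by simp
  have b_eq: "b (\<iota> h) = - ?\<delta> (coroot (\<alpha> (\<iota> h)))" if "h \<in> {1..r}" for h
    using b that form_inner_coroot[OF root[OF \<iota>(1)[OF that]] cartan_form_linear[OF delta_h_cartan_form]]
    by simp
  let ?\<nu> = "\<lambda>X. 2 * (\<Sum>h=1..r. a (\<iota> h) * \<pi> (\<iota> h) X)"
  have \<nu>: "?\<nu> \<in> cartan_forms \<aa>"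
    using weight_form \<iota>(1) by (intro cartan_form_scale cartan_form_sum) blast
  have agree: "koszul_form d (coroot \<gamma>) = ?\<nu> (coroot \<gamma>)" if \<gamma>: "\<gamma> \<in> \<Pi>" for \<gamma>
  proof -
    obtain j where j: "j \<in> {1..l}" "\<gamma> = \<alpha> j" using \<gamma> enum by (auto simp: bij_betw_def)
    have left: "koszul_form d (coroot \<gamma>) = 2 * (2 - ?\<delta> (coroot \<gamma>))"
      by (simp add: koszul_form_cartan coroot_in simple_root \<gamma> sum_positive_coroot)
    have right: "?\<nu> (coroot \<gamma>) = 2 * (\<Sum>h=1..r. if \<iota> h = j then a j else 0)"
      unfolding j(2) using \<iota>(1) j(1) by (intro arg_cong[of _ _ "(*) 2"] sum.cong) (auto simp: \<pi>_coroot)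
    show ?thesis
    proof (cases "\<gamma> \<in> \<Pi>1")
      case True
      then have "j \<in> \<iota> ` {1..r}" using enum1 j by (auto simp: bij_betw_def)
      then obtain h where h: "h \<in> {1..r}" "j = \<iota> h" by blast
      have "\<iota> h' = j \<longleftrightarrow> h' = h" if "h' \<in> {1..r}" for h'
        unfolding h(2) by (rule inj_on_eq_iff[OF inj_\<iota> that h(1)])
      then have "(\<Sum>h=1..r. if \<iota> h = j then a j else 0) = (\<Sum>h'=1..r. if h' = h then a j else 0)"
        by (intro sum.cong) auto
      also have "\<dots> = 2 - ?\<delta> (coroot \<gamma>)" using h a b_eq[OF h(1)] j(2) by simp
      finally show ?thesis unfolding left right by simp
    next
      case False
      then have "\<gamma> \<in> \<Pi>0" using \<gamma> decomp(1) by blast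
      moreover have "(\<Sum>h=1..r. if \<iota> h = j then a j else 0) = 0"
        using \<iota>(2) False j(2) by (intro sum.neutral) auto
      ultimately show ?thesis unfolding left right by (simp add: delta_h_coroot_\<Pi>0)
    qed
  qed
  have 2: "koszul_form d = ?\<nu>"
  proof (rule cartan_form_ext[OF koszul_cartan_form \<nu>])
    fix H assume H: "H \<in> \<aa>"
    have "linear_form (\<lambda>X. koszul_form d X - ?\<nu> X)"
      by (rule cartan_form_linear[OF cartan_form_diff[OF koszul_cartan_form \<nu>]])
    then have "koszul_form d H - ?\<nu> H = 0"
      by (rule coroots_separate[OF _ _ H]) (simp only: agree diff_self)
    then show "koszul_form d H = ?\<nu> H" by simp
  qed
  have inj: "inj_on (\<lambda>h. \<pi> (\<iota> h)) {1..r}"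
  proof (rule inj_onI)
    fix h h' assume h: "h \<in> {1..r}" "h' \<in> {1..r}" and eq: "\<pi> (\<iota> h) = \<pi> (\<iota> h')"
    have "\<pi> (\<iota> h) (coroot (\<alpha> (\<iota> h))) = 1" using \<pi>_coroot \<iota>(1) h by simp
    then have "\<iota> h' = \<iota> h"
      unfolding eq using \<pi>_coroot[OF \<iota>(1)[OF h(2)] \<iota>(1)[OF h(1)]] by (simp split: if_splits)
    then show "h = h'" using inj_on_eq_iff[OF inj_\<iota> h] by simp
  qed
  have P1_image: "P1 = (\<lambda>h. \<pi> (\<iota> h)) ` {1..r}" unfolding P1 by blast
  have "(\<Sum>\<omega>\<in>P1. n \<omega> * \<omega> X) = (\<Sum>h=1..r. a (\<iota> h) * \<pi> (\<iota> h) X)" for X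
    unfolding P1_image sum.reindex[OF inj] using n by (intro sum.cong) simp_all
  then have 1: "koszul_form d = (\<lambda>X. 2 * (\<Sum>\<omega>\<in>P1. n \<omega> * \<omega> X))" using 2 by simp
  have "b (\<iota> h) \<in> \<real> \<and> 0 \<le> Re (b (\<iota> h))" if h: "h \<in> {1..r}" for h
  proof -
    obtain k :: nat where "?\<delta> (coroot (\<alpha> (\<iota> h))) = - of_nat k"
      by (rule delta_h_coroot_\<Pi>1[OF \<iota>(2)[OF h]])
    then have "b (\<iota> h) = of_nat k" using b_eq[OF h] by simp
    then show ?thesis by simp
  qed
  then show ?thesis using 1 2 by blast
qed

end
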